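(* Consider the problem ELECTION-PREDICTION for the majority dynamics. \begin{enumerate} \item There is a 1-round proof labeling scheme for ELECTION-PREDICTION with certificates on $\mathcal O(\log n)$ bits in $n$-node networks of sub-exponential growth. \item There is a 1-round proof labeling scheme for ELECTION-PREDICTION with certificates on $\mathcal O(\log^2 n)$ bits in $n$-node networks of maximum degree $3$. \item There is a 1-round proof labeling scheme for ELECTION-PREDICTION with certificates on $\mathcal O(n^{1-\varepsilon}\log n)$ bits in $n$-node networks of maximum degree $\Delta>2$, where $\varepsilon=\frac{1}{\Delta\log(\Delta)}$. \end{enumerate}
   Context: Graphs (networks) are finite, simple, undirected and connected; $N(u)$ is the set of neighbors of $u$ and $d(u)=|N(u)|$. A configuration of $G=(V,E)$ is a map $x\in\{0,1\}^V$. Majority dynamics: from $x^0=x$, for every $t\ge 0$ and all nodes $u$ simultaneously, $x_u^{t+1}=1$ if $\sum_{v\in N(u)}x_v^t>d(u)/2$; $x_u^{t+1}=x_u^t$ if $\sum_{v\in N(u)}x_v^t=d(u)/2$; and $x_u^{t+1}=0$ otherwise. ELECTION-PREDICTION is the set of instances $(G,(x,T))$ where $x$ is a configuration of $G$, $T>0$ is an integer, and $\sum_{v\in V(G)}x_v^T>|V(G)|/2$. In an instance, each node $v$ has as input $(x_v,T)$, and the nodes carry distinct identifiers from $\{1,\dots,n^c\}$, with $c>1$ and $n$ the number of nodes. A 1-round proof labeling scheme for a distributed language $\mathcal L$ is a prover-verifier pair. The (non-trustable) prover assigns a certificate (binary string) to each node; certificates may depend on the whole instance including identifiers. The verifier is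 a distributed algorithm in which each node exchanges its certificate (and nothing else) with its neighbors in one round of communication, and then, from its own identifier, input and certificate and its neighbors' certificates, accepts or rejects. Completeness: if the instance is in $\mathcal L$, the prover can assign certificates such that all nodes accept. Soundness: if the instance is not in $\mathcal L$, then for every certificate assignment at least one node rejects. The size is the number of bits of the certificates assigned to the nodes. Growth: $B(v,k)$ is the set of nodes at distance at most $k$ from $v$, and $\partial B(v,k)=B(v,k)\setminus B(v,k-1)$. Given a function $f:\mathbb N\to\mathbb R$, a node $v$ has $f$-bounded growth if there exist constants $c_1,c_2>0$ such that, for every $k>0$, $c_1 f(k)\le|\partial B(v,k)|\le c_2 f(k)$. A graph has $f$-bounded growth if every one of its nodes has $f$-bounded growth, and a family of graphs has $f$-bounded growth if every graph in it does. Sub-exponential growth means $f$-bounded growth with $f$ a sub-exponential function (that is, $f(k)=2^{o(k)}$). $\log$ denotes the base-2 logarithm.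
   Formalization: As worded, no finite network has f-bounded growth with f(k)=2^{o(k)}>0, since spheres beyond the eccentricity are empty; here the lower bound is required only for non-empty spheres (c1 may depend on the node), and c2 is uniform over the family, as otherwise every graph would qualify. *)

theory Defs
  imports
    Complex_Main
    "HOL-Library.Multiset"
    "HOL-Library.Landau_Symbols"
    "Graph_Theory.Digraph_Component"
begin

section \<open>Networks and majority dynamics\<close>

text \<open>
  A finite simple undirected graph is a \<^emph>\<open>pair_graph\<close>: a finite, loop-free digraph whose arc
  relation is symmetric. Connectedness is qualified because Complex_Main has a topological
  constant of the same base name; it includes nonemptiness of the vertex set.
\<close>

definition network :: "'v pair_pre_digraph \<Rightarrow> bool" where
  "network G \<longleftrightarrow> pair_graph G \<and> Digraph_Component.connected (with_proj G)"

definition nbrs :: "'v pair_pre_digraph \<Rightarrow> 'v \<Rightarrow> 'v set" where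
  "nbrs G u = {v. (u, v) \<in> parcs G}"

definition deg :: "'v pair_pre_digraph \<Rightarrow> 'v \<Rightarrow> nat" where
  "deg G u = card (nbrs G u)"

definition max_degree_le :: "nat \<Rightarrow> 'v pair_pre_digraph \<Rightarrow> bool" where
  "max_degree_le \<Delta> G \<longleftrightarrow> (\<forall>v\<in>pverts G. deg G v \<le> \<Delta>)"

text \<open>Node states in $\{0,1\}$ are Booleans, with True for 1.\<close>

definition majority_step :: "'v pair_pre_digraph \<Rightarrow> ('v \<Rightarrow> bool) \<Rightarrow> 'v \<Rightarrow> bool" where
  "majority_step G x u =
    (let s = (\<Sum>v\<in>nbrs G u. of_bool (x v) :: real); h = real (deg G u) / 2
     in if s > h then True else if s = h then x u else False)"

definition majority_dynamics ::
    "'v pair_pre_digraph \<Rightarrow> ('v \<Rightarrow> bool) \<Rightarrow> nat \<Rightarrow> 'v \<Rightarrow> bool" where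
  "majority_dynamics G x t = (majority_step G ^^ t) x"

section \<open>Election prediction\<close>

type_synonym 'v election_instance = "'v pair_pre_digraph \<times> ('v \<Rightarrow> bool) \<times> nat"

definition election_prediction :: "'v election_instance set" where
  "election_prediction =
    {(G, x, T). network G \<and> T > 0 \<and>
       (\<Sum>v\<in>pverts G. of_bool (majority_dynamics G x T v) :: real) > real (card (pverts G)) / 2}"

section \<open>One-round proof labeling schemes\<close>

definition valid_ids :: "real \<Rightarrow> 'v pair_pre_digraph \<Rightarrow> ('v \<Rightarrow> nat) \<Rightarrow> bool" where
  "valid_ids c G ident \<longleftrightarrow> inj_on ident (pverts G) \<and>
     (\<forall>v\<in>pverts G. 1 \<le> ident v \<and> real (ident v) \<le> real (card (pverts G)) powr c)"

type_synonym certificate = "bool list"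

type_synonym 'v prover = "'v election_instance \<Rightarrow> ('v \<Rightarrow> nat) \<Rightarrow> 'v \<Rightarrow> certificate"

text \<open>
  A verifier is the local decision function: it is applied to the node's own identifier, its input
  $(x_v, T)$, its certificate and the multiset of its neighbors' certificates. Neither the
  neighbors' identifiers and inputs nor the number of nodes are available to it.
\<close>

type_synonym verifier =
  "nat \<Rightarrow> bool \<times> nat \<Rightarrow> certificate \<Rightarrow> certificate multiset \<Rightarrow> bool"

definition node_accepts ::
    "verifier \<Rightarrow> 'v election_instance \<Rightarrow> ('v \<Rightarrow> nat) \<Rightarrow> ('v \<Rightarrow> certificate) \<Rightarrow> 'v \<Rightarrow> bool" where
  "node_accepts V I ident cert v = (case I of (G, x, T) \<Rightarrow>
     V (ident v) (x v, T) (cert v) (image_mset cert (mset_set (nbrs G v))))"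

definition proof_labeling_scheme ::
    "real \<Rightarrow> 'v pair_pre_digraph set \<Rightarrow> 'v election_instance set \<Rightarrow> 'v prover \<Rightarrow> verifier \<Rightarrow> bool"
  where
  "proof_labeling_scheme c \<F> L P V \<longleftrightarrow>
    (\<forall>G\<in>\<F>. \<forall>x T ident. network G \<longrightarrow> valid_ids c G ident \<longrightarrow>
       ((G, x, T) \<in> L \<longrightarrow>
          (\<forall>v\<in>pverts G. node_accepts V (G, x, T) ident (P (G, x, T) ident) v)) \<and>
       ((G, x, T) \<notin> L \<longrightarrow>
          (\<forall>cert. \<exists>v\<in>pverts G. \<not> node_accepts V (G, x, T) ident cert v)))"

definition certificates_bounded ::
    "real \<Rightarrow> 'v pair_pre_digraph set \<Rightarrow> 'v election_instance set \<Rightarrow> 'v prover \<Rightarrow> (nat \<Rightarrow> real) \<Rightarrow> bool"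
  where
  "certificates_bounded c \<F> L P s \<longleftrightarrow>
    (\<forall>G\<in>\<F>. \<forall>x T ident. network G \<longrightarrow> valid_ids c G ident \<longrightarrow> (G, x, T) \<in> L \<longrightarrow>
       (\<forall>v\<in>pverts G. real (length (P (G, x, T) ident v)) \<le> s (card (pverts G))))"

definition has_pls_of_size ::
    "real \<Rightarrow> 'v pair_pre_digraph set \<Rightarrow> 'v election_instance set \<Rightarrow> (nat \<Rightarrow> real) \<Rightarrow> bool" where
  "has_pls_of_size c \<F> L g \<longleftrightarrow>
    (\<exists>P V s. proof_labeling_scheme c \<F> L P V \<and> certificates_bounded c \<F> L P s \<and> s \<in> O(g))"

section \<open>Growth\<close>

definition graph_ball :: "'v pair_pre_digraph \<Rightarrow> 'v \<Rightarrow> nat \<Rightarrow> 'v set" where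
  "graph_ball G v k = {u \<in> pverts G. \<exists>j\<le>k. (v, u) \<in> parcs G ^^ j}"

definition graph_sphere :: "'v pair_pre_digraph \<Rightarrow> 'v \<Rightarrow> nat \<Rightarrow> 'v set" where
  "graph_sphere G v k = graph_ball G v k - graph_ball G v (k - 1)"

text \<open>
  In a finite graph all sufficiently large spheres are empty, so the lower bound is required only
  for the nonempty ones (otherwise $f$ would have to vanish eventually).
\<close>

definition node_bounded_growth ::
    "(nat \<Rightarrow> real) \<Rightarrow> real \<Rightarrow> real \<Rightarrow> 'v pair_pre_digraph \<Rightarrow> 'v \<Rightarrow> bool" where
  "node_bounded_growth f c1 c2 G v \<longleftrightarrow>
    (\<forall>k>0. (graph_sphere G v k \<noteq> {} \<longrightarrow> c1 * f k \<le> real (card (graph_sphere G v k))) \<and>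
           real (card (graph_sphere G v k)) \<le> c2 * f k)"

text \<open>
  The upper constant is common to the whole family; if it could depend on the finite graph, every
  family would have $f$-bounded growth for every positive $f$. The lower constant may depend on the
  node, as spheres around a node of a finite graph (a torus, say) typically shrink near its
  eccentricity. Families with both constants uniform are a special case.
\<close>

definition family_bounded_growth ::
    "(nat \<Rightarrow> real) \<Rightarrow> 'v pair_pre_digraph set \<Rightarrow> bool" where
  "family_bounded_growth f \<F> \<longleftrightarrow>
    (\<exists>c2>0. \<forall>G\<in>\<F>. \<forall>v\<in>pverts G. \<exists>c1>0. node_bounded_growth f c1 c2 G v)"

text \<open>$f(k) = 2^{o(k)}$; as an asymptotic condition it does not constrain small $k$.\<close>

definition sub_exponential :: "(nat \<Rightarrow> real) \<Rightarrow> bool" where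
  "sub_exponential f \<longleftrightarrow>
    (\<exists>g \<in> o(\<lambda>k. real k). \<forall>\<^sub>F k in sequentially. f k = 2 powr g k)"

end

theory Submission
  imports Defs
begin

text \<open>
  A node is said to flip at time \<open>t\<close> if its states at \<open>t\<close> and \<open>t + 2\<close> differ. Weight the arcs by a
  function that decays geometrically, with ratio \<open>r = K / (K + 1)\<close> for degrees up to \<open>2 K + 1\<close>, in
  the distance to a node \<open>v\<close>. Then the weight of the arcs \<open>(u, w)\<close> with \<open>x u (t + 1) \<noteq> x w t\<close> never
  increases, and it drops by at least 1 when \<open>v\<close> flips (Goles-Olivos, Ginosar-Holzman). So \<open>v\<close> flips
  \<open>O(\<Sum>u. r ^ dist v u)\<close> times: a constant number of times under sub-exponential growth,
  \<open>O(log n)\<close> times for degree 3 and \<open>O(n powr (1 - \<epsilon>))\<close> times for degree \<open>\<Delta>\<close>. All flips occur within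
  polynomial time, so an orbit is described by its first two states and a list of numbers of
  \<open>O(log n)\<close> bits, which the neighbors can check against each other for all times at once. The
  votes at time \<open>T\<close> are added up along a spanning tree.
\<close>

section \<open>Distances in networks\<close>

locale net =
  fixes G :: "'v pair_pre_digraph"
  assumes network: "network G"
begin

lemma finite_verts: "finite (pverts G)"
  using network pair_fin_digraph.pair_finite_verts[of G]
  by (simp add: network_def pair_graph_def pair_digraph_def)

lemma verts_nonempty: "pverts G \<noteq> {}"
  using network by (auto simp: network_def connected_conv)

lemma card_verts_pos: "card (pverts G) > 0"
  using finite_verts verts_nonempty by (simp add: card_gt_0_iff)

lemma nbrs_subset: "nbrs G u \<subseteq> pverts G"
  using network pair_wf_digraph.in_arcsD2[of G]
  by (auto simp: network_def nbrs_def pair_graph_def pair_digraph_def pair_fin_digraph_def)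

lemma finite_nbrs: "finite (nbrs G u)"
  using finite_subset[OF nbrs_subset finite_verts] .

lemma sym_parcs: "sym (parcs G)"
  using network pair_sym_digraph.pair_sym_arcs[of G]
  by (simp add: network_def pair_graph_def pair_pseudo_graph_def symmetric_def)

lemma nbrs_sym: "v \<in> nbrs G u \<longleftrightarrow> u \<in> nbrs G v"
  using sym_parcs by (auto simp: nbrs_def sym_def)

lemma not_nbr_self: "u \<notin> nbrs G u"
  using network pair_loopfree_digraph.no_loops'[of G u u]
  by (auto simp: network_def nbrs_def pair_graph_def pair_digraph_def)

lemma reachable_relpow:
  assumes "u \<in> pverts G" "v \<in> pverts G"
  shows "\<exists>j. (u, v) \<in> parcs G ^^ j"
proof -
  have "(parcs G)\<^sup>s = parcs G"
    using sym_parcs by (auto simp: symcl_def sym_def)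
  then have "(u, v) \<in> rtrancl_on (pverts G) (parcs G)"
    using network assms by (simp add: network_def connected_conv)
  then have "(u, v) \<in> (parcs G)\<^sup>*"
    by (rule rtrancl_on_rtranclI)
  then show ?thesis
    by (simp add: rtrancl_power)
qed

definition hops :: "'v \<Rightarrow> 'v \<Rightarrow> nat" where
  "hops v u = (LEAST j. (v, u) \<in> parcs G ^^ j)"

lemma hops_relpow: "v \<in> pverts G \<Longrightarrow> u \<in> pverts G \<Longrightarrow> (v, u) \<in> parcs G ^^ hops v u"
  unfolding hops_def by (rule LeastI_ex, rule reachable_relpow)

lemma hops_le: "(v, u) \<in> parcs G ^^ j \<Longrightarrow> hops v u \<le> j"
  unfolding hops_def by (rule Least_le)

lemma hops_self [simp]: "hops v v = 0"
  using hops_le[of v v 0] by simp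

lemma hops_eq_0_iff: "v \<in> pverts G \<Longrightarrow> u \<in> pverts G \<Longrightarrow> hops v u = 0 \<longleftrightarrow> u = v"
  using hops_relpow[of v u] by auto

lemma hops_nbr:
  assumes "v \<in> pverts G" "u \<in> pverts G" "w \<in> nbrs G u"
  shows "hops v w \<le> Suc (hops v u)"
  using hops_relpow[OF assms(1,2)] assms(3) by (intro hops_le) (auto simp: nbrs_def)

lemma hops_pred:
  assumes "v \<in> pverts G" "u \<in> pverts G" "hops v u = Suc k"
  obtains w where "w \<in> nbrs G u" "hops v w = k"
proof -
  from hops_relpow[OF assms(1,2)] assms(3) obtain w
    where w: "(v, w) \<in> parcs G ^^ k" "(w, u) \<in> parcs G" by auto
  then have "w \<in> nbrs G u" "hops v w \<le> k"
    using nbrs_sym by (auto simp: nbrs_def hops_le)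
  moreover from this have "Suc k \<le> Suc (hops v w)"
    using hops_nbr[OF assms(1), of w u] assms(3) nbrs_subset nbrs_sym by auto
  ultimately show ?thesis using that by auto
qed

text \<open>Descending along predecessors, every distance from \<open>hops v u\<close> down to 0 is
  taken by some vertex, and distinct distances need distinct vertices.\<close>

lemma hops_less_card:
  assumes "v \<in> pverts G" "u \<in> pverts G"
  shows "hops v u < card (pverts G)"
proof -
  have "u \<in> pverts G \<Longrightarrow> {..hops v u} \<subseteq> hops v ` pverts G" for u
  proof (induction "hops v u" arbitrary: u)
    case 0 then show ?case using assms(1) by force
  next
    case (Suc k)
    obtain w where w: "w \<in> nbrs G u" "hops v w = k"
      using hops_pred[OF assms(1) Suc.prems Suc.hyps(2)[symmetric]] by blast
    then have "{..k} \<subseteq> hops v ` pverts G"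
      using Suc.hyps(1)[of w] nbrs_subset by auto
    moreover have "Suc k \<in> hops v ` pverts G" using Suc by (intro image_eqI[of _ _ u]) auto
    ultimately show ?case unfolding Suc.hyps(2)[symmetric] by (simp add: atMost_Suc)
  qed
  then have "card {..hops v u} \<le> card (hops v ` pverts G)"
    using assms(2) finite_verts by (intro card_mono) auto
  also have "\<dots> \<le> card (pverts G)"
    using finite_verts by (rule card_image_le)
  finally show ?thesis by simp
qed

section \<open>Distance levels and weighted sums over them\<close>

definition level :: "'v \<Rightarrow> nat \<Rightarrow> 'v set" where
  "level v i = {u \<in> pverts G. hops v u = i}"

lemma finite_level [simp]: "finite (level v i)"
  using finite_verts by (simp add: level_def)

lemma level_0: "v \<in> pverts G \<Longrightarrow> level v 0 = {v}"
  by (auto simp: level_def hops_eq_0_iff)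

lemma graph_ball_eq: "v \<in> pverts G \<Longrightarrow> graph_ball G v k = {u \<in> pverts G. hops v u \<le> k}"
  unfolding graph_ball_def using hops_relpow hops_le le_trans by blast

lemma graph_sphere_eq: "v \<in> pverts G \<Longrightarrow> k > 0 \<Longrightarrow> graph_sphere G v k = level v k"
  by (auto simp: graph_sphere_def graph_ball_eq level_def)

lemma level_1:
  assumes "v \<in> pverts G"
  shows "level v (Suc 0) = nbrs G v"
proof
  show "level v (Suc 0) \<subseteq> nbrs G v"
    using hops_relpow[OF assms] by (force simp: level_def nbrs_def)
  show "nbrs G v \<subseteq> level v (Suc 0)"
  proof
    fix u assume u: "u \<in> nbrs G v"
    then have "u \<in> pverts G" "u \<noteq> v" using nbrs_subset not_nbr_self by auto
    moreover have "hops v u \<le> Suc 0" using hops_nbr[OF assms assms u] by simp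
    ultimately show "u \<in> level v (Suc 0)"
      using hops_eq_0_iff[OF assms] by (simp add: level_def le_Suc_eq)
  qed
qed

text \<open>A node at positive distance spends at least one neighbor on the level before it, so at
  most \<open>\<Delta> - 1\<close> are left for the next level. Only the center can send all its
  neighbors outward.\<close>

lemma card_level_le:
  assumes v: "v \<in> pverts G" and "max_degree_le \<Delta> G"
  shows "card (level v (Suc i)) \<le> \<Delta> * (\<Delta> - 1) ^ i"
proof (induction i)
  case 0
  show ?case using assms by (simp add: level_1 max_degree_le_def deg_def)
next
  case (Suc i)
  have *: "card (nbrs G u \<inter> level v (Suc (Suc i))) \<le> \<Delta> - 1" if u: "u \<in> level v (Suc i)" for u
  proof -
    have uV: "u \<in> pverts G" and "hops v u = Suc i" using u by (auto simp: level_def)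
    then obtain w where w: "w \<in> nbrs G u" "hops v w = i" using hops_pred[OF v] by blast
    have "card (nbrs G u \<inter> level v (Suc (Suc i))) \<le> card (nbrs G u - {w})"
      using w finite_nbrs by (intro card_mono) (auto simp: level_def)
    also have "\<dots> = deg G u - 1" using w by (simp add: deg_def)
    also have "\<dots> \<le> \<Delta> - 1" using assms(2) uV by (auto simp: max_degree_le_def intro: diff_le_mono)
    finally show ?thesis .
  qed
  have "level v (Suc (Suc i)) \<subseteq> (\<Union>u\<in>level v (Suc i). nbrs G u \<inter> level v (Suc (Suc i)))"
  proof
    fix u assume u: "u \<in> level v (Suc (Suc i))"
    then obtain w where "w \<in> nbrs G u" "hops v w = Suc i"
      using hops_pred[OF v] by (auto simp: level_def)
    then have "w \<in> level v (Suc i)" "u \<in> nbrs G w"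
      using nbrs_subset nbrs_sym by (auto simp: level_def)
    then show "u \<in> (\<Union>u\<in>level v (Suc i). nbrs G u \<inter> level v (Suc (Suc i)))"
      using u by blast
  qed
  then have "card (level v (Suc (Suc i)))
      \<le> card (\<Union>u\<in>level v (Suc i). nbrs G u \<inter> level v (Suc (Suc i)))"
    by (intro card_mono) auto
  also have "\<dots> \<le> (\<Sum>u\<in>level v (Suc i). card (nbrs G u \<inter> level v (Suc (Suc i))))"
    by (rule card_UN_le) simp
  also have "\<dots> \<le> card (level v (Suc i)) * (\<Delta> - 1)"
    using sum_bounded_above[of "level v (Suc i)", OF *] by simp
  also have "\<dots> \<le> \<Delta> * (\<Delta> - 1) ^ i * (\<Delta> - 1)" by (intro mult_right_mono Suc.IH) simp
  finally show ?case by (simp add: ac_simps)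
qed

text \<open>Inside radius \<open>m\<close> the sum is grouped by levels, and outside every term is
  at most \<open>r ^ m\<close>. The cutoff is left free, so that each growth regime can choose its
  own.\<close>

lemma sum_power_hops_le:
  fixes r :: real
  assumes "0 \<le> r" "r \<le> 1"
  shows "(\<Sum>u\<in>pverts G. r ^ hops v u) \<le>
    (\<Sum>i<m. real (card (level v i)) * r ^ i) + real (card {u \<in> pverts G. m \<le> hops v u}) * r ^ m"
proof -
  let ?A = "{u \<in> pverts G. hops v u < m}" and ?B = "{u \<in> pverts G. m \<le> hops v u}"
  have "(\<Sum>u\<in>pverts G. r ^ hops v u) = (\<Sum>u\<in>?A \<union> ?B. r ^ hops v u)"
    by (rule sum.cong) auto
  also have "\<dots> = (\<Sum>u\<in>?A. r ^ hops v u) + (\<Sum>u\<in>?B. r ^ hops v u)"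
    using finite_verts by (intro sum.union_disjoint) auto
  also have "(\<Sum>u\<in>?A. r ^ hops v u) = (\<Sum>i<m. \<Sum>u\<in>{u \<in> ?A. hops v u = i}. r ^ hops v u)"
    using finite_verts by (intro sum.group[symmetric]) auto
  also have "\<dots> = (\<Sum>i<m. real (card (level v i)) * r ^ i)"
  proof (rule sum.cong)
    fix i assume "i \<in> {..<m}"
    then have "{u \<in> ?A. hops v u = i} = level v i" by (auto simp: level_def)
    then show "(\<Sum>u\<in>{u \<in> ?A. hops v u = i}. r ^ hops v u) = real (card (level v i)) * r ^ i"
      by (simp add: level_def)
  qed simp
  also have "(\<Sum>u\<in>?B. r ^ hops v u) \<le> real (card ?B) * r ^ m"
    using assms by (intro sum_bounded_above) (auto intro: power_decreasing)
  finally show ?thesis by simp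
qed

end

section \<open>The energy argument\<close>

lemma sum_of_bool_eq_card: "finite A \<Longrightarrow> (\<Sum>v\<in>A. of_bool (P v)) = real (card {v \<in> A. P v})"
  by (simp add: of_bool_def sum.If_cases Int_def)

text \<open>A loop at each node of even degree turns the tie-breaking rule into a strict majority.\<close>

definition odd_nbrs :: "'v pair_pre_digraph \<Rightarrow> 'v \<Rightarrow> 'v set" where
  "odd_nbrs G u = (if even (deg G u) then insert u (nbrs G u) else nbrs G u)"

context net
begin

lemma finite_odd_nbrs [simp]: "finite (odd_nbrs G u)"
  using finite_nbrs by (simp add: odd_nbrs_def)

lemma odd_nbrs_subset: "u \<in> pverts G \<Longrightarrow> odd_nbrs G u \<subseteq> pverts G"
  using nbrs_subset by (auto simp: odd_nbrs_def)

lemma odd_nbrs_sym: "v \<in> odd_nbrs G u \<longleftrightarrow> u \<in> odd_nbrs G v"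
  using nbrs_sym by (auto simp: odd_nbrs_def)

lemma odd_card_odd_nbrs: "odd (card (odd_nbrs G u))"
  using finite_nbrs not_nbr_self by (auto simp: odd_nbrs_def deg_def)

lemma card_odd_nbrs_le: "deg G u \<le> 2 * K + 1 \<Longrightarrow> card (odd_nbrs G u) \<le> 2 * K + 1"
  using finite_nbrs not_nbr_self by (auto simp: odd_nbrs_def deg_def elim!: evenE)

lemma majority_step_card:
  "majority_step G x u \<longleftrightarrow> 2 * card {v \<in> nbrs G u. x v} > deg G u \<or>
    2 * card {v \<in> nbrs G u. x v} = deg G u \<and> x u"
  by (auto simp: majority_step_def Let_def sum_of_bool_eq_card[OF finite_nbrs])

text \<open>For even degree the loop adds the own vote: it decides a tie and, by parity, cannot
  overturn a strict majority. For odd degree there is no tie.\<close>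

lemma majority_step_iff:
  "majority_step G x u \<longleftrightarrow> 2 * card {v \<in> odd_nbrs G u. x v} > card (odd_nbrs G u)"
proof -
  let ?s = "card {v \<in> nbrs G u. x v}"
  have maj: "majority_step G x u \<longleftrightarrow> 2 * ?s > deg G u \<or> 2 * ?s = deg G u \<and> x u"
    by (rule majority_step_card)
  show ?thesis
  proof (cases "even (deg G u)")
    case True
    have "{v \<in> insert u (nbrs G u). x v} =
        (if x u then insert u {v \<in> nbrs G u. x v} else {v \<in> nbrs G u. x v})" by auto
    then have "card {v \<in> odd_nbrs G u. x v} = ?s + of_bool (x u)"
      using True finite_nbrs not_nbr_self by (simp add: odd_nbrs_def)
    moreover have "card (odd_nbrs G u) = Suc (deg G u)"
      using True finite_nbrs not_nbr_self by (simp add: odd_nbrs_def deg_def)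
    moreover from True have "2 * ?s = deg G u \<or> 2 * ?s \<ge> deg G u + 2 \<or> 2 * ?s < deg G u"
      by presburger
    ultimately show ?thesis using maj by (cases "x u") auto
  next
    case False
    then have "2 * ?s \<noteq> deg G u" by presburger
    then show ?thesis using maj False by (auto simp: odd_nbrs_def deg_def)
  qed
qed

lemma card_agree_majority_step:
  assumes "z = majority_step G y u"
  shows "card {v \<in> odd_nbrs G u. y v \<noteq> z} < card {v \<in> odd_nbrs G u. y v = z}"
proof -
  let ?N = "odd_nbrs G u"
  have "{v \<in> ?N. y v \<noteq> z} = ?N - {v \<in> ?N. y v = z}" by auto
  then have "card {v \<in> ?N. y v \<noteq> z} + card {v \<in> ?N. y v = z} = card ?N"
    by (simp add: card_Diff_subset card_mono)
  moreover have "card {v \<in> ?N. y v} + card {v \<in> ?N. \<not> y v} = card ?N"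
    by (subst card_Un_disjoint[symmetric]) (auto intro!: arg_cong[where f = card])
  moreover have "2 * card {v \<in> ?N. y v} \<noteq> card ?N"
    using odd_card_odd_nbrs[of u] by (metis dvd_triv_left)
  ultimately show ?thesis
    using assms majority_step_iff[of y u] by (cases z) auto
qed

section \<open>Flips and the decreasing energy\<close>

definition flips :: "('v \<Rightarrow> bool) \<Rightarrow> 'v \<Rightarrow> nat set" where
  "flips x v = {t. majority_dynamics G x (t + 2) v \<noteq> majority_dynamics G x t v}"

lemma majority_dynamics_Suc:
  "majority_dynamics G x (Suc t) = majority_step G (majority_dynamics G x t)"
  by (simp add: majority_dynamics_def)

lemma majority_dynamics_0 [simp]: "majority_dynamics G x 0 = x"
  by (simp add: majority_dynamics_def)

text \<open>
  With arc weights \<open>max (b u) (b v)\<close>, each agreeing arc at \<open>u\<close> weighs at least \<open>b u\<close> and each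
  disagreeing one at most \<open>(K + 1) / K * b u\<close>. A strict majority has \<open>k + 1\<close> agreeing against
  \<open>k \<le> K\<close> disagreeing arcs, so no node can increase the energy by flipping.
\<close>

lemma card_flips_less_le:
  fixes b :: "'v \<Rightarrow> real"
  assumes K: "K > 0" and deg: "max_degree_le (2 * K + 1) G"
    and v0: "v0 \<in> pverts G" "b v0 = 1"
    and b: "\<And>u. u \<in> pverts G \<Longrightarrow> 0 < b u \<and> b u \<le> 1"
    and slow: "\<And>u v. u \<in> pverts G \<Longrightarrow> v \<in> nbrs G u \<Longrightarrow> b v \<le> real (K + 1) / real K * b u"
  shows "real (card (flips x v0 \<inter> {..<n})) \<le> real (4 * K + 2) * (\<Sum>u\<in>pverts G. b u)"
proof -
  define \<rho> where "\<rho> = real (K + 1) / real K"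
  define w where "w u v = max (b u) (b v)" for u v
  define X where "X = majority_dynamics G x"
  define J where "J t = (\<Sum>u\<in>pverts G. \<Sum>v\<in>odd_nbrs G u. w u v * of_bool (X (Suc t) u \<noteq> X t v))" for t
  have \<rho>: "1 \<le> \<rho>" "\<rho> \<le> 2" using K by (auto simp: \<rho>_def field_simps)
  have w_lower: "b u \<le> w u v" for u v by (simp add: w_def)
  have w_upper: "w u v \<le> \<rho> * b u" if "u \<in> pverts G" "v \<in> odd_nbrs G u" for u v
  proof -
    have "b u \<le> \<rho> * b u"
      using b[OF that(1)] \<rho> by simp
    moreover from this have "b v \<le> \<rho> * b u"
      using that slow[of u v] by (auto simp: odd_nbrs_def \<rho>_def split: if_splits)
    ultimately show ?thesis using b[OF that(1)] \<rho> by (simp add: w_def)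
  qed
  have w_le_1: "w u v \<le> 1" if "u \<in> pverts G" "v \<in> odd_nbrs G u" for u v
    using b that odd_nbrs_subset by (auto simp: w_def)
  have w_nonneg: "0 \<le> w u v" if "u \<in> pverts G" for u v
    using b[OF that] w_lower[of u v] by linarith
  \<comment> \<open>The share of \<open>u\<close> in the energy drop: its states at \<open>t\<close>
    and \<open>t + 2\<close> are compared with the same middle configuration. If \<open>u\<close>
    flips, its new state is the one held by the majority \<open>A\<close>.\<close>
  have gain: "of_bool (u = v0 \<and> X (Suc (Suc t)) u \<noteq> X t u)
      \<le> (\<Sum>v\<in>odd_nbrs G u. w u v * (of_bool (X t u \<noteq> X (Suc t) v) - of_bool (X (Suc (Suc t)) u \<noteq> X (Suc t) v)))"
    (is "_ \<le> ?D") if u: "u \<in> pverts G" for u t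
  proof (cases "X (Suc (Suc t)) u = X t u")
    case True then show ?thesis by simp
  next
    case False
    let ?N = "odd_nbrs G u"
    define z where "z = X (Suc (Suc t)) u"
    define A where "A = {v \<in> ?N. X (Suc t) v = z}"
    define B where "B = {v \<in> ?N. X (Suc t) v \<noteq> z}"
    have AB: "card B < card A"
      unfolding A_def B_def by (rule card_agree_majority_step) (simp add: z_def X_def majority_dynamics_Suc)
    have fin: "finite A" "finite B" and dis: "A \<inter> B = {}" and un: "?N = A \<union> B"
      by (auto simp: A_def B_def)
    have "card A + card B \<le> 2 * K + 1"
      using card_odd_nbrs_le[of u K] deg u un fin dis
      by (auto simp: max_degree_le_def card_Un_disjoint)
    with AB have BK: "card B \<le> K" by linarith
    have "?D = (\<Sum>v\<in>A. w u v) - (\<Sum>v\<in>B. w u v)"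
    proof -
      have "?D = (\<Sum>v\<in>A. w u v) + (\<Sum>v\<in>B. - w u v)"
        unfolding un sum.union_disjoint[OF fin dis] using False
        by (intro arg_cong2[where f = "(+)"] sum.cong) (auto simp: A_def B_def z_def)
      then show ?thesis by (simp add: sum_negf)
    qed
    moreover have "real (card A) * b u \<le> (\<Sum>v\<in>A. w u v)"
      using w_lower by (intro sum_bounded_below)
    moreover have "real (card B + 1) * b u \<le> real (card A) * b u"
      using AB b[OF u] by (intro mult_right_mono) auto
    moreover have "(\<Sum>v\<in>B. w u v) \<le> real (card B) * (\<rho> * b u)"
      using w_upper[OF u] un by (intro sum_bounded_above) auto
    moreover have "real (card B) * (\<rho> * b u) \<le> real (card B + 1) * b u"
    proof -
      have "real (card B) * real (K + 1) \<le> real (card B + 1) * real K"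
        using BK by (simp add: algebra_simps)
      then have "real (card B) * \<rho> \<le> real (card B + 1)" using K by (simp add: \<rho>_def field_simps)
      then show ?thesis using b[OF u] mult_right_mono[of _ _ "b u"] by (fastforce simp: mult.assoc)
    qed
    \<comment> \<open>At \<open>v0\<close> the cap of 1 on the weights gives more: \<open>A\<close>
      weighs at least \<open>card B + 1\<close> and \<open>B\<close> at most \<open>card B\<close>,
      so the drop is at least 1.\<close>
    moreover have "(\<Sum>v\<in>B. w u v) \<le> real (card B) * 1"
      using w_le_1[OF u] un by (intro sum_bounded_above) auto
    ultimately show ?thesis using v0(2) by (cases "u = v0") auto
  qed
  have drop: "of_bool (X (Suc (Suc t)) v0 \<noteq> X t v0) \<le> J t - J (Suc t)" for t
  proof -
    \<comment> \<open>Exchanging the two ends of each arc, by symmetry of \<open>w\<close>, puts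
      \<open>X t\<close> at the outer index. Then \<open>J t\<close> and \<open>J (Suc t)\<close>
      differ only in the state at that index.\<close>
    have "J t = (\<Sum>u\<in>pverts G. \<Sum>v\<in>pverts G. of_bool (v \<in> odd_nbrs G u) * (w u v * of_bool (X (Suc t) u \<noteq> X t v)))"
      unfolding J_def using finite_verts odd_nbrs_subset
      by (intro sum.cong sum.mono_neutral_cong_left) auto
    also have "\<dots> = (\<Sum>v\<in>pverts G. \<Sum>u\<in>pverts G. of_bool (v \<in> odd_nbrs G u) * (w u v * of_bool (X (Suc t) u \<noteq> X t v)))"
      by (rule sum.swap)
    also have "\<dots> = (\<Sum>v\<in>pverts G. \<Sum>u\<in>odd_nbrs G v. w v u * of_bool (X t v \<noteq> X (Suc t) u))"
      using finite_verts odd_nbrs_subset odd_nbrs_sym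
      by (intro sum.cong sum.mono_neutral_cong_right) (auto simp: w_def max.commute)
    finally have "J t - J (Suc t) = (\<Sum>u\<in>pverts G. \<Sum>v\<in>odd_nbrs G u.
        w u v * (of_bool (X t u \<noteq> X (Suc t) v) - of_bool (X (Suc (Suc t)) u \<noteq> X (Suc t) v)))"
      unfolding J_def by (simp only: right_diff_distrib sum_subtractf)
    also have "\<dots> \<ge> (\<Sum>u\<in>pverts G. of_bool (u = v0 \<and> X (Suc (Suc t)) u \<noteq> X t u))"
      by (intro sum_mono gain)
    moreover have "(\<Sum>u\<in>pverts G. of_bool (u = v0 \<and> X (Suc (Suc t)) u \<noteq> X t u))
        \<ge> (of_bool (X (Suc (Suc t)) v0 \<noteq> X t v0) :: real)"
      using member_le_sum[OF v0(1), of "\<lambda>u. of_bool (u = v0 \<and> X (Suc (Suc t)) u \<noteq> X t u) :: real"]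
        finite_verts by simp
    ultimately show ?thesis by linarith
  qed
  have "flips x v0 \<inter> {..<n} = {t \<in> {..<n}. X (Suc (Suc t)) v0 \<noteq> X t v0}"
    by (auto simp: flips_def X_def)
  then have "real (card (flips x v0 \<inter> {..<n})) = (\<Sum>t<n. of_bool (X (Suc (Suc t)) v0 \<noteq> X t v0))"
    by (simp only: sum_of_bool_eq_card[OF finite_lessThan])
  also have "\<dots> \<le> (\<Sum>t<n. J t - J (Suc t))"
    by (intro sum_mono drop)
  also have "\<dots> = J 0 - J n"
    by (rule sum_lessThan_telescope')
  also have "\<dots> \<le> J 0"
    using w_nonneg by (simp add: J_def sum_nonneg)
  also have "J 0 \<le> (\<Sum>u\<in>pverts G. real (2 * K + 1) * (2 * b u))"
    unfolding J_def
  proof (rule sum_mono)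
    fix u assume u: "u \<in> pverts G"
    have "w u v * of_bool (X (Suc 0) u \<noteq> X 0 v) \<le> 2 * b u" if "v \<in> odd_nbrs G u" for v
    proof -
      have "\<rho> * b u \<le> 2 * b u" using b[OF u] \<rho> by (intro mult_right_mono) auto
      then show ?thesis using w_upper[OF u that] w_nonneg[OF u, of v] by auto
    qed
    then have "(\<Sum>v\<in>odd_nbrs G u. w u v * of_bool (X (Suc 0) u \<noteq> X 0 v)) \<le> real (card (odd_nbrs G u)) * (2 * b u)"
      by (rule sum_bounded_above)
    also have "\<dots> \<le> real (2 * K + 1) * (2 * b u)"
      using b[OF u] u card_odd_nbrs_le[of u K] deg by (intro mult_right_mono) (auto simp: max_degree_le_def)
    finally show "(\<Sum>v\<in>odd_nbrs G u. w u v * of_bool (X (Suc 0) u \<noteq> X 0 v)) \<le> real (2 * K + 1) * (2 * b u)" .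
  qed
  also have "\<dots> = real (4 * K + 2) * (\<Sum>u\<in>pverts G. b u)"
    unfolding sum_distrib_left by (intro sum.cong) (simp_all add: algebra_simps)
  finally show ?thesis .
qed

text \<open>The weights \<open>b u = r ^ hops v u\<close> qualify: distances of adjacent nodes
  differ by at most 1, so \<open>b\<close> grows by at most the factor \<open>1 / r\<close>, which
  is at most \<open>(K + 1) / K\<close>. The bound is the same for all time windows, whence
  finiteness.\<close>

lemma finite_card_flips_le:
  fixes r :: real
  assumes "K > 0" "max_degree_le (2 * K + 1) G" "v \<in> pverts G"
    and r: "real K / real (K + 1) \<le> r" "r \<le> 1"
  shows "finite (flips x v) \<and> real (card (flips x v)) \<le> real (4 * K + 2) * (\<Sum>u\<in>pverts G. r ^ hops v u)"
proof -
  define C where "C = real (4 * K + 2) * (\<Sum>u\<in>pverts G. r ^ hops v u)"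
  have r0: "0 < r" using r(1) assms(1) by (meson divide_pos_pos less_le_trans of_nat_0_less_iff zero_less_Suc add_pos_pos zero_less_one)
  have bound: "real (card (flips x v \<inter> {..<n})) \<le> C" for n
    unfolding C_def
  proof (rule card_flips_less_le[OF assms(1-3)])
    show "0 < r ^ hops v u \<and> r ^ hops v u \<le> 1" for u
      using r0 r(2) by (simp add: power_le_one)
  next
    fix u w assume u: "u \<in> pverts G" and w: "w \<in> nbrs G u"
    have "hops v u \<le> Suc (hops v w)"
      using hops_nbr[OF assms(3), of w u] w nbrs_subset nbrs_sym by auto
    then have "r ^ Suc (hops v w) \<le> r ^ hops v u"
      using r0 r(2) by (intro power_decreasing) auto
    moreover have "real K / real (K + 1) * r ^ hops v w \<le> r * r ^ hops v w"
      using r(1) r0 by (intro mult_right_mono) auto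
    ultimately have "real K / real (K + 1) * r ^ hops v w \<le> r ^ hops v u"
      by simp
    then show "r ^ hops v w \<le> real (K + 1) / real K * r ^ hops v u"
      using assms(1) by (simp add: field_simps)
  qed simp
  have card: "card F \<le> nat \<lfloor>C\<rfloor>" if F: "F \<subseteq> flips x v" "finite F" for F
  proof -
    obtain n where "F \<subseteq> {..<n}" using F(2) finite_nat_iff_bounded by blast
    then have "card F \<le> card (flips x v \<inter> {..<n})" using F by (intro card_mono) auto
    then show ?thesis using bound[of n] by (simp add: le_nat_floor)
  qed
  then have fin: "finite (flips x v) \<and> card (flips x v) \<le> nat \<lfloor>C\<rfloor>"
    by (rule finite_if_finite_subsets_card_bdd)
  then obtain n where "flips x v \<subseteq> {..<n}" using finite_nat_iff_bounded by blast
  then have "flips x v \<inter> {..<n} = flips x v" by auto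
  then show ?thesis using fin bound[of n] by (simp add: C_def)
qed

text \<open>
  Once no node flips, none ever flips again; hence a flip at time \<open>t\<close> is preceded by \<open>t\<close> others.
\<close>

lemma flip_time_le:
  assumes "K > 0" "max_degree_le (2 * K + 1) G" "v \<in> pverts G" "t \<in> flips x v"
  shows "t \<le> (4 * K + 2) * card (pverts G) ^ 2"
proof -
  let ?n = "card (pverts G)"
  let ?F = "\<Union>u\<in>pverts G. flips x u"
  have single: "finite (flips x u)" "card (flips x u) \<le> (4 * K + 2) * ?n" if "u \<in> pverts G" for u
  proof -
    have *: "finite (flips x u) \<and> real (card (flips x u)) \<le> real ((4 * K + 2) * ?n)"
      using finite_card_flips_le[OF assms(1,2) that, of 1 x] by (simp add: algebra_simps)
    then show "finite (flips x u)" by blast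
    show "card (flips x u) \<le> (4 * K + 2) * ?n"
      using * of_nat_le_iff by blast
  qed
  \<comment> \<open>A time without flips makes the configurations at \<open>s\<close> and
    \<open>s + 2\<close> equal on the vertices, hence also those at \<open>s + 1\<close> and
    \<open>s + 3\<close>.\<close>
  have closed: "s \<in> ?F" if "Suc s \<in> ?F" for s
  proof (rule ccontr)
    assume "s \<notin> ?F"
    then have eq: "\<forall>u\<in>pverts G. majority_dynamics G x (s + 2) u = majority_dynamics G x s u"
      by (auto simp: flips_def)
    have "majority_dynamics G x (Suc s + 2) u = majority_dynamics G x (Suc s) u" if "u \<in> pverts G" for u
    proof -
      have "{v \<in> odd_nbrs G u. majority_dynamics G x (s + 2) v} = {v \<in> odd_nbrs G u. majority_dynamics G x s v}"
        using eq odd_nbrs_subset[OF that] by auto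
      then show ?thesis by (simp add: majority_dynamics_Suc majority_step_iff)
    qed
    with that show False by (auto simp: flips_def)
  qed
  have initial: "t \<in> ?F \<Longrightarrow> {..t} \<subseteq> ?F" for t
  proof (induction t)
    case (Suc t)
    then show ?case using closed by (auto simp: atMost_Suc)
  qed auto
  have "{..t} \<subseteq> ?F" by (rule initial) (use assms in auto)
  moreover have "finite ?F" using single finite_verts by auto
  ultimately have "Suc t \<le> card ?F" using card_mono[of ?F "{..t}"] by simp
  also have "\<dots> \<le> (\<Sum>u\<in>pverts G. card (flips x u))" by (rule card_UN_le[OF finite_verts])
  also have "\<dots> \<le> ?n * ((4 * K + 2) * ?n)"
    using sum_bounded_above[of "pverts G" "\<lambda>u. card (flips x u)" "(4 * K + 2) * ?n"] single by simp
  finally show ?thesis by (simp add: power2_eq_square algebra_simps)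
qed

end

section \<open>Certificates\<close>

text \<open>A prefix-free code: every binary digit is preceded by True, and False ends the number.\<close>

fun nat_code :: "nat \<Rightarrow> bool list" where
  "nat_code n = (if n = 0 then [False] else True # odd n # nat_code (n div 2))"

declare nat_code.simps [simp del]

text \<open>The first bit tells whether the number ends; otherwise two bits are stripped from both
  strings and both numbers are halved. The free tails let one code be split off a
  concatenation.\<close>

lemma nat_code_append_eq: "nat_code m @ xs = nat_code n @ ys \<Longrightarrow> m = n \<and> xs = ys"
proof (induction m arbitrary: n rule: nat_code.induct)
  case (1 m)
  have *: "nat_code m @ xs = nat_code n @ ys" by fact
  show ?case
  proof (cases "m = 0 \<or> n = 0")
    case True
    then show ?thesis
      using * by (subst (asm) (1 2) nat_code.simps) (auto split: if_splits)
  next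
    case False
    have step: "odd m \<longleftrightarrow> odd n" "nat_code (m div 2) @ xs = nat_code (n div 2) @ ys"
      using * False by (subst (asm) (1 2) nat_code.simps, simp)+
    have IH: "m div 2 = n div 2 \<and> xs = ys"
      by (rule 1(1)) (use False step(2) in auto)
    then have "m div 2 = n div 2" by (rule conjunct1)
    with step(1) have "m = n" by presburger
    with IH show ?thesis by blast
  qed
qed

lemma nat_code_not_Nil: "nat_code n \<noteq> []"
  by (subst nat_code.simps) simp

lemma concat_nat_code_inject: "concat (map nat_code ms) = concat (map nat_code ns) \<Longrightarrow> ms = ns"
proof (induction ms arbitrary: ns)
  case Nil then show ?case by (cases ns) (auto simp: nat_code_not_Nil)
next
  case (Cons m ms)
  then show ?case by (cases ns) (auto simp: nat_code_not_Nil dest: nat_code_append_eq)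
qed

text \<open>Halving \<open>n\<close> saves two bits, and halving \<open>B\<close> lowers
  \<open>2 * log 2 B\<close> by exactly two; the 3 covers the numbers below 2.\<close>

lemma length_nat_code_le:
  "1 \<le> B \<Longrightarrow> real n \<le> B \<Longrightarrow> real (length (nat_code n)) \<le> 2 * log 2 B + 3"
proof (induction n arbitrary: B rule: nat_code.induct)
  case (1 n)
  show ?case
  proof (cases "n < 2")
    case True
    then have "n = 0 \<or> n = 1" by linarith
    then have "length (nat_code n) \<le> 3"
      by (auto simp: nat_code.simps[of 0] nat_code.simps[of "Suc 0"])
    then show ?thesis using zero_le_log_cancel_iff[of 2 B] 1(2) by linarith
  next
    case False
    have "real (length (nat_code (n div 2))) \<le> 2 * log 2 (B / 2) + 3"
      using False 1(2,3) by (intro 1(1)) linarith+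
    moreover have "log 2 (B / 2) = log 2 B - 1"
      using 1(2) by (simp add: log_divide)
    moreover have "length (nat_code n) = 2 + length (nat_code (n div 2))"
      using False by (subst nat_code.simps) simp
    ultimately show ?thesis by simp
  qed
qed

text \<open>
  The fields \<open>parent_id\<close>, \<open>depth\<close> and \<open>subtotal\<close> certify the vote count along a spanning tree.
  The orbit is certified by its first two states and its flips with respect to period two.
\<close>

datatype label =
  Label (own_id: nat) (parent_id: nat) (depth: nat) (subtotal: int)
    (state0: bool) (state1: bool) (flip_times: "nat list")

text \<open>The integer \<open>s\<close> is stored by its positive and negative parts. The flip
  times come last, so that the end of the string delimits them.\<close>

fun label_nats :: "label \<Rightarrow> nat list" where
  "label_nats (Label i p d s a b F) = [i, p, d, nat s, nat (- s), of_bool a, of_bool b] @ F"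

definition encode :: "label \<Rightarrow> certificate" where
  "encode l = concat (map nat_code (label_nats l))"

lemma inj_encode: "inj encode"
proof (rule injI)
  fix l m assume "encode l = encode m"
  then have "label_nats l = label_nats m"
    unfolding encode_def by (rule concat_nat_code_inject)
  then show "l = m"
    by (cases l; cases m) (auto simp: of_bool_def split: if_splits)
qed

lemma length_encode_le:
  assumes "1 \<le> B" "\<And>n. n \<in> set (label_nats l) \<Longrightarrow> real n \<le> B"
  shows "real (length (encode l)) \<le> real (length (label_nats l)) * (2 * log 2 B + 3)"
proof -
  have "real (length (concat (map nat_code ns))) \<le> real (length ns) * (2 * log 2 B + 3)"
    if "\<And>n. n \<in> set ns \<Longrightarrow> real n \<le> B" for ns
    using that length_nat_code_le[OF assms(1)]
    by (induction ns) (auto simp: distrib_right intro!: add_mono)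
  then show ?thesis using assms(2) by (simp add: encode_def)
qed

text \<open>Any \<open>F\<close> yields a total sequence, so even a forged certificate claims a
  state for every time.\<close>

fun orbit :: "bool \<Rightarrow> bool \<Rightarrow> nat set \<Rightarrow> nat \<Rightarrow> bool" where
  "orbit a b F 0 = a"
| "orbit a b F (Suc 0) = b"
| "orbit a b F (Suc (Suc t)) = (orbit a b F t \<noteq> (t \<in> F))"

definition claimed :: "label \<Rightarrow> nat \<Rightarrow> bool" where
  "claimed l = orbit (state0 l) (state1 l) (set (flip_times l))"

lemma orbit_flips: "orbit (X 0) (X 1) {t. X (t + 2) \<noteq> X t} t = X t"
  by (induction t rule: induct_nat_012) auto

text \<open>Signed votes turn the comparison with half the number of nodes into positivity of a sum,
  which can be checked without knowing that number.\<close>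

definition vote :: "bool \<Rightarrow> int" where
  "vote b = (if b then 1 else - 1)"

text \<open>The quantifier over all \<open>t\<close> is admissible because a verifier is an
  arbitrary function. Strictly decreasing depth excludes cycles of parents. Every node of depth 0 is
  a root and must show a positive subtotal, so even a forest with several roots proves a positive
  total.\<close>

definition node_check :: "nat \<Rightarrow> bool \<times> nat \<Rightarrow> label \<Rightarrow> label multiset \<Rightarrow> bool" where
  "node_check i inp l M \<longleftrightarrow>
     snd inp > 0 \<and> own_id l = i \<and> state0 l = fst inp \<and>
     (\<forall>t. claimed l (Suc t) \<longleftrightarrow>
        2 * size {#m \<in># M. claimed m t#} > size M \<or>
        2 * size {#m \<in># M. claimed m t#} = size M \<and> claimed l t) \<and>
     subtotal l = vote (claimed l (snd inp)) +
       (\<Sum>m\<in>#{#m \<in># M. depth m > 0 \<and> parent_id m = i#}. subtotal m) \<and>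
     (if depth l = 0 then subtotal l > 0
      else \<exists>m. m \<in># M \<and> own_id m = parent_id l \<and> depth m < depth l)"

text \<open>\<open>inv encode\<close> returns an arbitrary label on strings that encode none, which soundness tolerates.\<close>

definition election_verifier :: verifier where
  "election_verifier i inp c M = node_check i inp (inv encode c) (image_mset (inv encode) M)"

section \<open>Soundness of the local check\<close>

context net
begin

lemma size_filter_nbrs:
  "size (filter_mset P (image_mset f (mset_set (nbrs G u)))) = card {v \<in> nbrs G u. P (f v)}"
  using finite_nbrs by (simp add: filter_mset_image_mset comp_def)

lemma sum_filter_nbrs:
  "(\<Sum>m\<in>#filter_mset P (image_mset f (mset_set (nbrs G u))). g m) = (\<Sum>v\<in>{v \<in> nbrs G u. P (f v)}. g (f v))"
  using finite_nbrs
  by (simp add: filter_mset_image_mset comp_def image_mset.compositionality sum_unfold_sum_mset)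

lemma node_check_iff:
  "node_check i (a, T) (l u) (image_mset l (mset_set (nbrs G u))) \<longleftrightarrow>
     T > 0 \<and> own_id (l u) = i \<and> state0 (l u) = a \<and>
     (\<forall>t. claimed (l u) (Suc t) \<longleftrightarrow> majority_step G (\<lambda>v. claimed (l v) t) u) \<and>
     subtotal (l u) = vote (claimed (l u) T) +
       (\<Sum>v\<in>{v \<in> nbrs G u. depth (l v) > 0 \<and> parent_id (l v) = i}. subtotal (l v)) \<and>
     (if depth (l u) = 0 then subtotal (l u) > 0
      else \<exists>v\<in>nbrs G u. own_id (l v) = parent_id (l u) \<and> depth (l v) < depth (l u))"
  unfolding node_check_def majority_step_card size_filter_nbrs sum_filter_nbrs
  by (simp add: deg_def Bex_def finite_nbrs)

lemma election_prediction_iff: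
  "(G, x, T) \<in> election_prediction \<longleftrightarrow>
     T > 0 \<and> (\<Sum>v\<in>pverts G. vote (majority_dynamics G x T v)) > 0"
proof -
  have "real_of_int (vote b) = 2 * of_bool b - 1" for b
    by (simp add: vote_def)
  then have "real_of_int (\<Sum>v\<in>pverts G. vote (majority_dynamics G x T v)) =
      2 * (\<Sum>v\<in>pverts G. of_bool (majority_dynamics G x T v)) - real (card (pverts G))"
    by (simp add: sum_subtractf sum_distrib_left)
  then have "(\<Sum>v\<in>pverts G. vote (majority_dynamics G x T v)) > 0 \<longleftrightarrow>
      (\<Sum>v\<in>pverts G. of_bool (majority_dynamics G x T v) :: real) > real (card (pverts G)) / 2"
    by linarith
  then show ?thesis using network by (simp add: election_prediction_def)
qed

text \<open>Induction on time forces the claimed states to be the true ones. Summing the subtotal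
  equations over all nodes cancels every non-root subtotal, as it enters at exactly one parent, and
  leaves the total vote as a sum of positive root subtotals.\<close>

lemma node_check_sound:
  assumes ident: "inj_on ident (pverts G)"
    and check: "\<And>u. u \<in> pverts G \<Longrightarrow> node_check (ident u) (x u, T) (l u) (image_mset l (mset_set (nbrs G u)))"
  shows "(G, x, T) \<in> election_prediction"
proof -
  note checks = check[unfolded node_check_iff]
  have states: "claimed (l u) t = majority_dynamics G x t u" if "u \<in> pverts G" for u t
    using that
  proof (induction t arbitrary: u)
    case 0
    then show ?case using checks[of u] by (simp add: claimed_def)
  next
    case (Suc t)
    have "{v \<in> nbrs G u. claimed (l v) t} = {v \<in> nbrs G u. majority_dynamics G x t v}"
      using Suc.IH nbrs_subset by blast
    then show ?case
      using checks[OF Suc.prems] Suc.IH[OF Suc.prems]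
      by (simp add: majority_dynamics_Suc majority_step_card)
  qed
  let ?R = "{u \<in> pverts G. depth (l u) = 0}" and ?C = "{u \<in> pverts G. depth (l u) > 0}"
  \<comment> \<open>Distinct identifiers, together with the check of \<open>own_id\<close>, make the
    named parent unique, so each subtotal is counted once.\<close>
  have parent: "card {u \<in> nbrs G v. ident u = parent_id (l v)} = 1" if v: "v \<in> ?C" for v
  proof -
    obtain u where u: "u \<in> nbrs G v" "own_id (l u) = parent_id (l v)"
      using checks[of v] v by auto
    moreover have "u \<in> pverts G" using u(1) nbrs_subset by blast
    ultimately have "ident u = parent_id (l v)" using checks[of u] by simp
    moreover from this have "w = u" if "w \<in> nbrs G v" "ident w = parent_id (l v)" for w
      using that nbrs_subset u(1) by (intro inj_onD[OF ident]) auto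
    ultimately have "{u \<in> nbrs G v. ident u = parent_id (l v)} = {u}"
      using u(1) by blast
    then show ?thesis by simp
  qed
  have "(\<Sum>u\<in>pverts G. \<Sum>v\<in>{v \<in> nbrs G u. depth (l v) > 0 \<and> parent_id (l v) = ident u}. subtotal (l v))
      = (\<Sum>u\<in>pverts G. \<Sum>v\<in>{v \<in> ?C. u \<in> nbrs G v \<and> ident u = parent_id (l v)}. subtotal (l v))"
    using nbrs_subset nbrs_sym by (intro sum.cong) auto
  also have "\<dots> = (\<Sum>v\<in>?C. \<Sum>u\<in>{u \<in> pverts G. u \<in> nbrs G v \<and> ident u = parent_id (l v)}. subtotal (l v))"
    using finite_verts by (intro sum.swap_restrict) auto
  also have "\<dots> = (\<Sum>v\<in>?C. subtotal (l v))"
  proof (rule sum.cong)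
    fix v assume v: "v \<in> ?C"
    have "{u \<in> pverts G. u \<in> nbrs G v \<and> ident u = parent_id (l v)} = {u \<in> nbrs G v. ident u = parent_id (l v)}"
      using nbrs_subset by auto
    then show "(\<Sum>u\<in>{u \<in> pverts G. u \<in> nbrs G v \<and> ident u = parent_id (l v)}. subtotal (l v)) = subtotal (l v)"
      using parent[OF v] by simp
  qed simp
  finally have children: "(\<Sum>u\<in>pverts G. \<Sum>v\<in>{v \<in> nbrs G u. depth (l v) > 0 \<and> parent_id (l v) = ident u}. subtotal (l v))
      = (\<Sum>v\<in>?C. subtotal (l v))" .
  have "(\<Sum>u\<in>pverts G. subtotal (l u)) = (\<Sum>u\<in>pverts G. vote (majority_dynamics G x T u) +
      (\<Sum>v\<in>{v \<in> nbrs G u. depth (l v) > 0 \<and> parent_id (l v) = ident u}. subtotal (l v)))"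
    using checks states by (intro sum.cong) auto
  also have "\<dots> = (\<Sum>u\<in>pverts G. vote (majority_dynamics G x T u)) + (\<Sum>v\<in>?C. subtotal (l v))"
    by (simp only: sum.distrib children)
  also have "(\<Sum>u\<in>pverts G. subtotal (l u)) = (\<Sum>u\<in>?R. subtotal (l u)) + (\<Sum>u\<in>?C. subtotal (l u))"
    using finite_verts by (subst sum.union_disjoint[symmetric]) (auto intro: sum.cong)
  finally have total: "(\<Sum>u\<in>pverts G. vote (majority_dynamics G x T u)) = (\<Sum>u\<in>?R. subtotal (l u))"
    by simp
  \<comment> \<open>A node of least depth has no neighbor of smaller depth, so it is a root and the
    sum over the roots is not empty.\<close>
  obtain r where r: "r \<in> pverts G" "\<forall>u. u \<in> pverts G \<longrightarrow> depth (l r) \<le> depth (l u)"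
    using verts_nonempty ex_has_least_nat[of "\<lambda>u. u \<in> pverts G" _ "\<lambda>u. depth (l u)"] by blast
  have "depth (l r) = 0"
  proof (rule ccontr)
    assume "depth (l r) \<noteq> 0"
    then obtain u where "u \<in> nbrs G r" "depth (l u) < depth (l r)"
      using checks[OF r(1)] by auto
    then show False using r(2) nbrs_subset leD by blast
  qed
  then have "?R \<noteq> {}" using r(1) by auto
  moreover have "subtotal (l u) > 0" if "u \<in> ?R" for u
    using checks[of u] that by simp
  ultimately have "(\<Sum>u\<in>?R. subtotal (l u)) > 0"
    using finite_verts by (intro sum_pos) auto
  moreover have "T > 0" using checks r(1) by blast
  ultimately show ?thesis using total by (simp add: election_prediction_iff)
qed

section \<open>Breadth-first tree and subtree sums\<close>

definition tree_parent :: "'v \<Rightarrow> 'v \<Rightarrow> 'v" where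
  "tree_parent r u = (SOME w. w \<in> nbrs G u \<and> Suc (hops r w) = hops r u)"

lemma tree_parent:
  assumes "r \<in> pverts G" "u \<in> pverts G" "hops r u > 0"
  shows "tree_parent r u \<in> nbrs G u \<and> Suc (hops r (tree_parent r u)) = hops r u"
  unfolding tree_parent_def
proof (rule someI_ex)
  obtain k where "hops r u = Suc k" using assms(3) gr0_implies_Suc by blast
  then show "\<exists>w. w \<in> nbrs G u \<and> Suc (hops r w) = hops r u"
    using hops_pred[OF assms(1,2)] by metis
qed

definition subtree :: "'v \<Rightarrow> 'v \<Rightarrow> 'v set" where
  "subtree r v = {u \<in> pverts G. hops r v \<le> hops r u \<and> (tree_parent r ^^ (hops r u - hops r v)) u = v}"

lemma ancestor:
  assumes "r \<in> pverts G" "u \<in> pverts G"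
  shows "k \<le> hops r u \<Longrightarrow> (tree_parent r ^^ k) u \<in> pverts G \<and> hops r ((tree_parent r ^^ k) u) = hops r u - k"
proof (induction k)
  case (Suc k)
  then show ?case
    using tree_parent[OF assms(1), of "(tree_parent r ^^ k) u"] nbrs_subset by force
qed (use assms in simp)

lemma subtree_root: "r \<in> pverts G \<Longrightarrow> subtree r r = pverts G"
proof -
  assume r: "r \<in> pverts G"
  have "(tree_parent r ^^ hops r u) u = r" if "u \<in> pverts G" for u
    using ancestor[OF r that, of "hops r u"] hops_eq_0_iff[OF r, of "(tree_parent r ^^ hops r u) u"] by simp
  then show ?thesis by (auto simp: subtree_def)
qed

text \<open>The proper descendants of \<open>v\<close> are split by the child of \<open>v\<close>
  through which they climb. Children share one depth, so a descendant climbs to only one of them and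
  the parts are disjoint.\<close>

lemma sum_subtree:
  fixes f :: "'v \<Rightarrow> int"
  assumes r: "r \<in> pverts G" and v: "v \<in> pverts G"
  shows "sum f (subtree r v) =
    f v + (\<Sum>c\<in>{c \<in> nbrs G v. hops r c > 0 \<and> tree_parent r c = v}. sum f (subtree r c))"
proof -
  let ?C = "{c \<in> nbrs G v. hops r c > 0 \<and> tree_parent r c = v}"
  have hops_child: "hops r c = Suc (hops r v)" if "c \<in> ?C" for c
  proof -
    have "c \<in> pverts G" using that nbrs_subset by blast
    then show ?thesis using that tree_parent[OF r, of c] by simp
  qed
  have "u \<in> insert v (\<Union>c\<in>?C. subtree r c)" if u: "u \<in> subtree r v" for u
  proof (cases "hops r u = hops r v")
    case True then show ?thesis using u by (simp add: subtree_def)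
  next
    case False
    \<comment> \<open>Climbing stops one step short of \<open>v\<close>, so that \<open>c\<close> is
      a child of \<open>v\<close>.\<close>
    define k where "k = hops r u - Suc (hops r v)"
    define c where "c = (tree_parent r ^^ k) u"
    have uV: "u \<in> pverts G" and less: "hops r v < hops r u"
      using u False by (auto simp: subtree_def)
    have c: "c \<in> pverts G" "hops r c = Suc (hops r v)"
      using ancestor[OF r uV, of k] less by (auto simp: c_def k_def)
    have "hops r u - hops r v = Suc k" using less by (simp add: k_def)
    then have "tree_parent r c = v" using u by (simp add: subtree_def c_def)
    moreover from this have "c \<in> nbrs G v"
      using tree_parent[OF r c(1)] c(2) nbrs_sym by auto
    moreover have "u \<in> subtree r c"
      using c uV less by (auto simp: subtree_def c_def[symmetric] k_def[symmetric])
    ultimately show ?thesis using c(2) by auto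
  qed
  moreover have "u \<in> subtree r v" if "c \<in> ?C" "u \<in> subtree r c" for u c
  proof -
    have "hops r c \<le> hops r u" "(tree_parent r ^^ (hops r u - hops r c)) u = c" "u \<in> pverts G"
      using that(2) by (auto simp: subtree_def)
    moreover from this have "hops r u - hops r v = Suc (hops r u - hops r c)"
      using hops_child[OF that(1)] by simp
    ultimately show ?thesis using that(1) hops_child[OF that(1)] by (simp add: subtree_def)
  qed
  moreover have "v \<in> subtree r v" using v by (simp add: subtree_def)
  ultimately have eq: "subtree r v = insert v (\<Union>c\<in>?C. subtree r c)" by blast
  have fin: "finite (subtree r c)" for c using finite_verts by (simp add: subtree_def)
  have "v \<notin> (\<Union>c\<in>?C. subtree r c)" using hops_child by (force simp: subtree_def)
  moreover have "sum f (\<Union>c\<in>?C. subtree r c) = (\<Sum>c\<in>?C. sum f (subtree r c))"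
  proof (rule sum.UNION_disjoint)
    have "c = d" if "c \<in> ?C" "d \<in> ?C" "u \<in> subtree r c" "u \<in> subtree r d" for c d u
      using that(3,4) hops_child[OF that(1)] hops_child[OF that(2)] by (simp add: subtree_def)
    then show "\<forall>c\<in>?C. \<forall>d\<in>?C. c \<noteq> d \<longrightarrow> subtree r c \<inter> subtree r d = {}"
      by blast
  qed (use finite_nbrs fin in auto)
  ultimately show ?thesis
    unfolding eq using finite_nbrs fin by (subst sum.insert) auto
qed

section \<open>Honest certificates: acceptance and length\<close>

text \<open>The choice of the root depends on the graph alone, so all nodes agree on it. Its parent
  entry 0 is a dummy that the check never reads, since only nodes of positive depth are matched with
  a parent.\<close>

definition honest_label :: "('v \<Rightarrow> bool) \<Rightarrow> nat \<Rightarrow> ('v \<Rightarrow> nat) \<Rightarrow> 'v \<Rightarrow> label" where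
  "honest_label x T ident v =
    (let r = SOME r. r \<in> pverts G in
     Label (ident v) (if hops r v = 0 then 0 else ident (tree_parent r v)) (hops r v)
       (\<Sum>u\<in>subtree r v. vote (majority_dynamics G x T u))
       (x v) (majority_dynamics G x 1 v) (sorted_list_of_set (flips x v)))"

lemma claimed_honest_label:
  assumes "finite (flips x v)"
  shows "claimed (honest_label x T ident v) t = majority_dynamics G x t v"
  using orbit_flips[of "\<lambda>t. majority_dynamics G x t v" t] assms
  by (simp add: claimed_def honest_label_def Let_def flips_def)

lemma finite_flips:
  assumes "v \<in> pverts G"
  shows "finite (flips x v)"
proof -
  have "deg G u \<le> 2 * card (pverts G) + 1" for u
    using card_mono[OF finite_verts nbrs_subset, of u] unfolding deg_def by linarith
  then have "max_degree_le (2 * card (pverts G) + 1) G"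
    by (simp add: max_degree_le_def)
  then show ?thesis
    using finite_card_flips_le[OF card_verts_pos _ assms, of 1] by simp
qed

lemma node_check_honest_label:
  assumes ident: "inj_on ident (pverts G)" and inst: "(G, x, T) \<in> election_prediction"
    and u: "u \<in> pverts G"
  shows "node_check (ident u) (x u, T) (honest_label x T ident u)
    (image_mset (honest_label x T ident) (mset_set (nbrs G u)))"
proof -
  define r where "r = (SOME r. r \<in> pverts G)"
  have r: "r \<in> pverts G" unfolding r_def using verts_nonempty by (simp add: some_in_eq)
  let ?l = "honest_label x T ident"
  have l: "own_id (?l v) = ident v" "parent_id (?l v) = (if hops r v = 0 then 0 else ident (tree_parent r v))"
    "depth (?l v) = hops r v" "subtotal (?l v) = (\<Sum>u\<in>subtree r v. vote (majority_dynamics G x T u))"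
    "state0 (?l v) = x v" for v
    by (simp_all add: honest_label_def Let_def r_def)
  have claims: "claimed (?l v) t = majority_dynamics G x t v" if "v \<in> pverts G" for v t
    using that by (intro claimed_honest_label finite_flips)
  have "{v \<in> nbrs G u. claimed (?l v) t} = {v \<in> nbrs G u. majority_dynamics G x t v}" for t
    using claims nbrs_subset by blast
  then have "claimed (?l u) (Suc t) \<longleftrightarrow> majority_step G (\<lambda>v. claimed (?l v) t) u" for t
    using claims[OF u] by (simp add: majority_dynamics_Suc majority_step_card)
  \<comment> \<open>Injectivity of \<open>ident\<close> makes the neighbors that name
    \<open>u\<close> as parent exactly its children in the tree.\<close>
  moreover have "{v \<in> nbrs G u. depth (?l v) > 0 \<and> parent_id (?l v) = ident u}
      = {c \<in> nbrs G u. hops r c > 0 \<and> tree_parent r c = u}"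
    using inj_onD[OF ident _ _ u] tree_parent[OF r] nbrs_subset by (auto simp: l subset_iff)
  then have "subtotal (?l u) = vote (claimed (?l u) T) +
       (\<Sum>v\<in>{v \<in> nbrs G u. depth (?l v) > 0 \<and> parent_id (?l v) = ident u}. subtotal (?l v))"
    using sum_subtree[OF r u] claims[OF u] by (simp only: l)
  moreover have "T > 0" and total: "(\<Sum>v\<in>pverts G. vote (majority_dynamics G x T v)) > 0"
    using inst by (simp_all add: election_prediction_iff)
  moreover have "subtotal (?l u) > 0" if "depth (?l u) = 0"
    using that total hops_eq_0_iff[OF r u] subtree_root[OF r] by (simp add: l)
  moreover have "\<exists>v\<in>nbrs G u. own_id (?l v) = parent_id (?l u) \<and> depth (?l v) < depth (?l u)" if "depth (?l u) \<noteq> 0"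
    using that tree_parent[OF r u] by (intro bexI[of _ "tree_parent r u"]) (auto simp: l)
  ultimately show ?thesis unfolding node_check_iff by (simp add: l)
qed

text \<open>One polynomial bound \<open>B\<close> covers every number: identifiers are at most
  \<open>n powr c\<close>, flip times at most \<open>(4 * K + 2) * n powr 2\<close>, depths and
  absolute subtotals at most \<open>n\<close>. The 7 counts the fixed fields.\<close>

lemma length_honest_label_le:
  assumes c: "c > 1" and ids: "valid_ids c G ident"
    and K: "K > 0" "max_degree_le (2 * K + 1) G" and v: "v \<in> pverts G"
  shows "real (length (encode (honest_label x T ident v))) \<le>
    (7 + real (card (flips x v))) * (2 * log 2 (real (4 * K + 2) * real (card (pverts G)) powr (c + 2)) + 3)"
proof -
  define r where "r = (SOME r. r \<in> pverts G)"
  have r: "r \<in> pverts G" unfolding r_def using verts_nonempty by (simp add: some_in_eq)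
  define n where "n = real (card (pverts G))"
  define B where "B = real (4 * K + 2) * n powr (c + 2)"
  let ?s = "\<Sum>u\<in>subtree r v. vote (majority_dynamics G x T u)"
  have n1: "1 \<le> n" using card_verts_pos by (simp add: n_def)
  then have "1 \<le> n powr (c + 2)" using c by (simp add: ge_one_powr_ge_zero)
  then have nB: "n powr (c + 2) \<le> B" and B1: "1 \<le> B"
    using mult_mono[of 1 "real (4 * K + 2)" "n powr (c + 2)" "n powr (c + 2)"] by (auto simp: B_def)
  have "n powr 1 \<le> n powr (c + 2)" using n1 c by (intro powr_mono) auto
  then have n_le: "n \<le> B" using n1 nB by simp
  have ident_le: "real (ident u) \<le> B" if "u \<in> pverts G" for u
  proof -
    have "n powr c \<le> n powr (c + 2)" using n1 by (intro powr_mono) auto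
    then show ?thesis using ids that nB by (fastforce simp: valid_ids_def n_def)
  qed
  have flip_le: "real t \<le> B" if "t \<in> flips x v" for t
  proof -
    have "real t \<le> real ((4 * K + 2) * card (pverts G) ^ 2)"
      using flip_time_le[OF K v that] by (simp only: of_nat_le_iff)
    also have "\<dots> = real (4 * K + 2) * n powr 2" using n1 by (simp add: n_def powr_numeral algebra_simps)
    also have "\<dots> \<le> B" unfolding B_def using n1 c by (intro mult_left_mono powr_mono) auto
    finally show ?thesis .
  qed
  have "\<bar>?s\<bar> \<le> (\<Sum>u\<in>subtree r v. 1)"
    by (rule order_trans[OF sum_abs], rule sum_mono) (simp add: vote_def)
  also have "\<dots> \<le> int (card (pverts G))"
    using finite_verts by (auto simp: subtree_def intro!: card_mono)
  finally have "\<bar>real_of_int ?s\<bar> \<le> n" unfolding n_def by linarith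
  then have "real (nat ?s) \<le> B" "real (nat (- ?s)) \<le> B" using n_le B1 by (cases "?s \<ge> 0"; simp)+
  moreover have "real (hops r v) \<le> B" using hops_less_card[OF r v] n_le by (simp add: n_def)
  moreover have "real (if hops r v = 0 then 0 else ident (tree_parent r v)) \<le> B"
    using ident_le tree_parent[OF r v] nbrs_subset B1 by auto
  moreover have "real (of_bool b) \<le> B" for b using B1 by simp
  ultimately have bound: "real k \<le> B" if "k \<in> set (label_nats (honest_label x T ident v))" for k
    using that ident_le[OF v] flip_le finite_flips[OF v]
    by (auto simp: honest_label_def Let_def r_def[symmetric] simp del: of_nat_of_bool)
  have "length (label_nats (honest_label x T ident v)) = 7 + card (flips x v)"
    by (simp add: honest_label_def Let_def)
  then show ?thesis
    using length_encode_le[OF B1, of "honest_label x T ident v", OF bound]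
    by (simp add: B_def n_def)
qed

end

section \<open>From distance sums to certificate sizes\<close>

definition election_prover :: "'v prover" where
  "election_prover I ident v = (case I of (G, x, T) \<Rightarrow> encode (net.honest_label G x T ident v))"

lemma election_scheme:
  "proof_labeling_scheme c \<F> election_prediction election_prover election_verifier"
  unfolding proof_labeling_scheme_def
proof (intro ballI allI impI conjI)
  fix G :: "'v pair_pre_digraph" and x T ident
  assume "network G" "valid_ids c G ident"
  then interpret net G by unfold_locales
  have ident: "inj_on ident (pverts G)" using \<open>valid_ids c G ident\<close> by (simp add: valid_ids_def)
  have decode: "inv encode (election_prover (G, x, T) ident v) = honest_label x T ident v" for v
    by (simp add: election_prover_def inj_encode)
  then have decode_comp: "inv encode \<circ> election_prover (G, x, T) ident = honest_label x T ident"
    by (simp add: fun_eq_iff)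
  {
    fix v assume "(G, x, T) \<in> election_prediction" "v \<in> pverts G"
    then show "node_accepts election_verifier (G, x, T) ident (election_prover (G, x, T) ident) v"
      using node_check_honest_label[OF ident]
      by (simp add: decode decode_comp node_accepts_def election_verifier_def image_mset.compositionality)
  next
    fix cert assume no: "(G, x, T) \<notin> election_prediction"
    show "\<exists>v\<in>pverts G. \<not> node_accepts election_verifier (G, x, T) ident cert v"
      using node_check_sound[OF ident, of x T "inv encode \<circ> cert"] no
      by (auto simp: node_accepts_def election_verifier_def image_mset.compositionality)
  }
qed

text \<open>The bound \<open>h\<close> on the distance sum controls the flips up to the factor
  \<open>4 * K + 2\<close>, and every stored number costs \<open>O(log n)\<close> bits. Thus each
  size bound reduces to estimating one sum.\<close>

lemma has_pls_of_sizeI: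
  fixes \<F> :: "'v pair_pre_digraph set"
  assumes c: "c > 1" and K: "K > 0"
    and deg: "\<And>G. G \<in> \<F> \<Longrightarrow> network G \<Longrightarrow> max_degree_le (2 * K + 1) G"
    and h: "\<And>G v. G \<in> \<F> \<Longrightarrow> network G \<Longrightarrow> v \<in> pverts G \<Longrightarrow>
      (\<Sum>u\<in>pverts G. (real K / real (K + 1)) ^ net.hops G v u) \<le> h (card (pverts G))"
    and h0: "\<And>n. 0 \<le> h n"
    and g: "(\<lambda>n. (1 + h n) * log 2 (real n)) \<in> O(g)"
  shows "has_pls_of_size c \<F> election_prediction g"
proof -
  define s where "s n = (7 + real (4 * K + 2) * h n) * (2 * log 2 (real (4 * K + 2) * real n powr (c + 2)) + 3)" for n :: nat
  have "certificates_bounded c \<F> election_prediction election_prover s"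
    unfolding certificates_bounded_def
  proof (intro ballI allI impI)
    fix G x T ident v
    assume G: "G \<in> \<F>" "network G" and ids: "valid_ids c G ident" and v: "v \<in> pverts G"
    interpret net G using G(2) by unfold_locales
    let ?L = "2 * log 2 (real (4 * K + 2) * real (card (pverts G)) powr (c + 2)) + 3"
    have "1 \<le> real (card (pverts G)) powr (c + 2)"
      using card_verts_pos c by (intro ge_one_powr_ge_zero) auto
    then have "1 * 1 \<le> real (4 * K + 2) * real (card (pverts G)) powr (c + 2)"
      by (intro mult_mono) auto
    then have L: "0 \<le> ?L" using zero_le_log_cancel_iff[of 2 "real (4 * K + 2) * real (card (pverts G)) powr (c + 2)"] by auto
    have "real (card (flips x v)) \<le> real (4 * K + 2) * (\<Sum>u\<in>pverts G. (real K / real (K + 1)) ^ hops v u)"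
      using finite_card_flips_le[OF K deg[OF G] v] by simp
    also have "\<dots> \<le> real (4 * K + 2) * h (card (pverts G))"
      by (intro mult_left_mono h G v) simp
    finally have flips: "real (card (flips x v)) \<le> real (4 * K + 2) * h (card (pverts G))" .
    have "real (length (election_prover (G, x, T) ident v)) \<le> (7 + real (card (flips x v))) * ?L"
      using length_honest_label_le[OF c ids K deg[OF G] v] by (simp add: election_prover_def)
    also have "\<dots> \<le> s (card (pverts G))"
      unfolding s_def using flips L by (intro mult_right_mono) auto
    finally show "real (length (election_prover (G, x, T) ident v)) \<le> s (card (pverts G))" .
  qed
  moreover have "s \<in> O(\<lambda>n. (1 + h n) * log 2 (real n))"
  proof (rule bigoI)
    \<comment> \<open>From \<open>n = 2\<close> on the logarithm is at least 1 and absorbs constant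
      terms; \<open>D\<close> collects the resulting coefficients. The other factor
      \<open>4 * K + 9\<close> is \<open>7 + (4 * K + 2)\<close>.\<close>
    define D where "D = 2 * log 2 (real (4 * K + 2)) + 2 * (c + 2) + 3"
    show "\<forall>\<^sub>F n in sequentially. norm (s n) \<le> (real (4 * K + 9) * D) * norm ((1 + h n) * log 2 (real n))"
      using eventually_ge_at_top[of 2]
    proof eventually_elim
      case (elim n)
      let ?L = "2 * log 2 (real (4 * K + 2) * real n powr (c + 2)) + 3"
      have log1: "1 \<le> log 2 (real n)" using elim by (simp add: le_log_iff)
      have logK: "0 \<le> log 2 (real (4 * K + 2))" by simp
      have L: "?L = 2 * log 2 (real (4 * K + 2)) + 2 * (c + 2) * log 2 (real n) + 3"
      proof -
        have "log 2 (real (4 * K + 2) * real n powr (c + 2)) = log 2 (real (4 * K + 2)) + log 2 (real n powr (c + 2))"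
          using elim by (intro log_mult_pos) auto
        then show ?thesis using elim by (simp only: log_powr) (simp add: algebra_simps log_powr)
      qed
      have "2 * log 2 (real (4 * K + 2)) * 1 \<le> 2 * log 2 (real (4 * K + 2)) * log 2 (real n)"
        using log1 logK by (intro mult_left_mono) auto
      then have L_le: "?L \<le> D * log 2 (real n)"
        unfolding L D_def distrib_right using log1 by linarith
      have L0: "0 \<le> ?L" unfolding L using log1 logK c by (intro add_nonneg_nonneg mult_nonneg_nonneg) auto
      have "7 + real (4 * K + 2) * h n \<le> real (4 * K + 9) * (1 + h n)"
        using h0[of n] by (simp add: algebra_simps)
      then have "s n \<le> real (4 * K + 9) * (1 + h n) * (D * log 2 (real n))"
        unfolding s_def using L_le L0 h0[of n] by (intro mult_mono) auto
      moreover have "0 \<le> s n" unfolding s_def using L0 h0[of n] by (intro mult_nonneg_nonneg) auto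
      moreover have "norm ((1 + h n) * log 2 (real n)) = (1 + h n) * log 2 (real n)"
        using log1 h0[of n] by simp
      ultimately show ?case by (simp only: real_norm_def abs_of_nonneg) (simp only: mult_ac)
    qed
  qed
  ultimately show ?thesis
    unfolding has_pls_of_size_def using election_scheme landau_o.big_trans[OF _ g] by blast
qed

section \<open>Growth\<close>

text \<open>With \<open>r = 2 powr (- 2 * \<delta>)\<close>, half of the decay eventually absorbs
  \<open>f\<close>, whose exponent is at most \<open>\<delta> * k\<close>; the other half leaves a
  convergent geometric series.\<close>

lemma summable_sub_exponential:
  assumes "sub_exponential f" and r: "0 < r" "r < 1"
  shows "summable (\<lambda>k. \<bar>f k\<bar> * r ^ k)"
proof -
  obtain g where g: "g \<in> o(\<lambda>k. real k)" "\<forall>\<^sub>F k in sequentially. f k = 2 powr g k"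
    using assms(1) by (auto simp: sub_exponential_def)
  define \<delta> where "\<delta> = - log 2 r / 2"
  have \<delta>: "\<delta> > 0" using r by (simp add: \<delta>_def)
  have r_eq: "r = 2 powr (- 2 * \<delta>)" using r by (simp add: \<delta>_def)
  have "\<forall>\<^sub>F k in sequentially. norm (g k) \<le> \<delta> * norm (real k)"
    using landau_o.smallD[OF g(1) \<delta>] .
  with g(2) have "\<forall>\<^sub>F k in sequentially. norm (\<bar>f k\<bar> * r ^ k) \<le> (2 powr (- \<delta>)) ^ k"
  proof eventually_elim
    case (elim k)
    have "norm (\<bar>f k\<bar> * r ^ k) = 2 powr (g k - 2 * \<delta> * real k)"
      using r(1) elim(1) by (simp add: r_eq powr_power powr_add[symmetric] mult.commute)
    also have "\<dots> \<le> 2 powr (- \<delta> * real k)"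
      using elim(2) by (intro powr_mono) auto
    also have "\<dots> = (2 powr (- \<delta>)) ^ k" by (simp add: powr_power mult.commute)
    finally show ?case .
  qed
  moreover have "summable (\<lambda>k. (2 powr (- \<delta>)) ^ k)"
    using \<delta> by (intro summable_geometric) (simp add: powr_minus field_simps)
  ultimately show ?thesis by (rule summable_comparison_test_ev)
qed

lemma has_pls_sub_exponential:
  fixes \<F> :: "'v pair_pre_digraph set"
  assumes c: "c > 1" and f: "sub_exponential f" and \<F>: "family_bounded_growth f \<F>"
  shows "has_pls_of_size c \<F> election_prediction (\<lambda>n. log 2 (real n))"
proof -
  obtain c2 where c2: "c2 > 0" and
    growth: "\<And>G v. G \<in> \<F> \<Longrightarrow> v \<in> pverts G \<Longrightarrow> \<exists>c1>0. node_bounded_growth f c1 c2 G v"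
    using \<F> by (auto simp: family_bounded_growth_def)
  \<comment> \<open>The sphere of radius 1 bounds every degree by \<open>c2 * f 1\<close>, so one
    \<open>K\<close> serves the whole family; \<open>Suc\<close> keeps it positive.\<close>
  define K where "K = Suc (nat \<lceil>c2 * f 1\<rceil>)"
  define r where "r = real K / real (K + 1)"
  define C where "C = 1 + c2 * (\<Sum>i. \<bar>f i\<bar> * r ^ i)"
  have r: "0 < r" "r < 1" by (simp_all add: r_def K_def)
  note sums = summable_sub_exponential[OF f r]
  have level: "real (card (net.level G v (Suc i))) \<le> c2 * f (Suc i)"
    if G: "G \<in> \<F>" "network G" and v: "v \<in> pverts G" for G v i
  proof -
    interpret net G using G(2) by unfold_locales
    have "real (card (graph_sphere G v (Suc i))) \<le> c2 * f (Suc i)"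
      using growth[OF G(1) v] by (auto simp: node_bounded_growth_def)
    then show ?thesis by (simp add: graph_sphere_eq[OF v])
  qed
  have C1: "1 \<le> C"
    using suminf_nonneg[OF sums] r(1) c2 by (simp add: C_def)
  show ?thesis
  proof (rule has_pls_of_sizeI[OF c, of K \<F> "\<lambda>_. C"])
    show "K > 0" by (simp add: K_def)
  next
    fix G assume G: "G \<in> \<F>" "network G"
    interpret net G using G(2) by unfold_locales
    show "max_degree_le (2 * K + 1) G"
      unfolding max_degree_le_def
    proof
      fix v assume v: "v \<in> pverts G"
      have "real (deg G v) \<le> c2 * f 1"
        using level[OF G v, of 0] level_1[OF v] by (simp add: deg_def)
      also have "\<dots> \<le> real (nat \<lceil>c2 * f 1\<rceil>)" by (rule real_nat_ceiling_ge)
      finally show "deg G v \<le> 2 * K + 1" unfolding K_def of_nat_le_iff by simp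
    qed
  next
    fix G v assume G: "G \<in> \<F>" "network G" and v: "v \<in> pverts G"
    interpret net G using G(2) by unfold_locales
    let ?m = "card (pverts G)"
    have empty: "{u \<in> pverts G. ?m \<le> hops v u} = {}"
      using hops_less_card[OF v] by force
    have "(\<Sum>u\<in>pverts G. r ^ hops v u) \<le> (\<Sum>i<?m. real (card (level v i)) * r ^ i)"
      using sum_power_hops_le[of r v ?m] r unfolding empty by simp
    \<comment> \<open>Level 0 is the center alone, outside the growth bound, and accounts for the
      summand 1 in \<open>C\<close>. Absolute values are taken because the sign of
      \<open>f 0\<close> is free.\<close>
    also have "\<dots> \<le> (\<Sum>i<?m. of_bool (i = 0) + c2 * (\<bar>f i\<bar> * r ^ i))"
    proof (rule sum_mono)
      fix i
      show "real (card (level v i)) * r ^ i \<le> of_bool (i = 0) + c2 * (\<bar>f i\<bar> * r ^ i)"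
      proof (cases i)
        case 0 then show ?thesis using v c2 by (simp add: level_0)
      next
        case (Suc j)
        have "real (card (level v i)) \<le> c2 * \<bar>f i\<bar>"
          using level[OF G v, of j] c2 Suc by (meson abs_ge_self less_imp_le mult_left_mono order_trans)
        then show ?thesis using r Suc mult_right_mono[of _ _ "r ^ i"] by (fastforce simp: mult.assoc)
      qed
    qed
    also have "\<dots> = (\<Sum>i<?m. of_bool (i = 0)) + c2 * (\<Sum>i<?m. \<bar>f i\<bar> * r ^ i)"
      by (simp add: sum.distrib sum_distrib_left)
    also have "(\<Sum>i<?m. of_bool (i = 0)) = (1::real)"
      using card_verts_pos by (simp add: of_bool_def)
    also have "(\<Sum>i<?m. \<bar>f i\<bar> * r ^ i) \<le> (\<Sum>i. \<bar>f i\<bar> * r ^ i)"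
      using r by (intro sum_le_suminf[OF sums]) auto
    finally show "(\<Sum>u\<in>pverts G. (real K / real (K + 1)) ^ hops v u) \<le> C"
      using c2 by (simp add: C_def r_def)
  next
    show "(\<lambda>n. (1 + C) * log 2 (real n)) \<in> O(\<lambda>n. log 2 (real n))"
      using C1 by simp
  qed (use C1 in simp)
qed

section \<open>Maximum degree 3\<close>

text \<open>Here \<open>K = 1\<close> and \<open>r = 1 / 2\<close>: the decay offsets the doubling
  of the levels, so each of about \<open>log n\<close> levels adds at most 2 to the distance
  sum.\<close>

lemma has_pls_max_degree_3:
  assumes c: "c > 1"
  shows "has_pls_of_size c {G :: 'v pair_pre_digraph. max_degree_le 3 G} election_prediction
    (\<lambda>n. (log 2 (real n))\<^sup>2)"
proof (rule has_pls_of_sizeI[OF c, of 1 _ "\<lambda>n. 4 + 2 * \<bar>log 2 (real n)\<bar>"])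
  fix G :: "'v pair_pre_digraph" and v
  assume "G \<in> {G. max_degree_le 3 G}" "network G" and v: "v \<in> pverts G"
  then have deg: "max_degree_le 3 G" by simp
  interpret net G using \<open>network G\<close> by unfold_locales
  let ?n = "real (card (pverts G))"
  \<comment> \<open>At this cutoff \<open>2 ^ m\<close> is at least \<open>n\<close>, so the tail
    weighs at most 1.\<close>
  define m where "m = nat \<lceil>log 2 ?n\<rceil>"
  have n1: "1 \<le> ?n" using card_verts_pos by simp
  then have "log 2 ?n \<le> real m" "real m \<le> 1 + log 2 ?n"
    by (auto simp: m_def) linarith
  then have n_le: "?n \<le> 2 ^ m" using n1 by (simp add: log_le_iff powr_realpow)
  have "real (card (level v i)) * (1 / 2) ^ i \<le> 2" for i
  proof (cases i)
    case 0 then show ?thesis using v by (simp add: level_0)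
  next
    case (Suc j)
    have "real (card (level v i)) \<le> real (3 * 2 ^ j)"
      using card_level_le[OF v deg, of j] unfolding Suc of_nat_le_iff by simp
    then show ?thesis unfolding Suc by (simp add: field_simps)
  qed
  then have "(\<Sum>i<m. real (card (level v i)) * (1 / 2) ^ i) \<le> real (card {..<m}) * 2"
    by (intro sum_bounded_above)
  moreover have "real (card {u \<in> pverts G. m \<le> hops v u}) * (1 / 2) ^ m \<le> ?n * (1 / 2) ^ m"
    using finite_verts by (intro mult_right_mono) (auto intro!: card_mono)
  moreover have "?n * (1 / 2) ^ m \<le> 1" using n_le by (simp add: field_simps)
  moreover have "(\<Sum>u\<in>pverts G. (1 / 2) ^ hops v u) \<le>
      (\<Sum>i<m. real (card (level v i)) * (1 / 2) ^ i) + real (card {u \<in> pverts G. m \<le> hops v u}) * (1 / 2) ^ m"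
    by (rule sum_power_hops_le) auto
  ultimately have "(\<Sum>u\<in>pverts G. (1 / 2) ^ hops v u) \<le> real m * 2 + 1"
    unfolding card_lessThan by linarith
  then show "(\<Sum>u\<in>pverts G. (real 1 / real (1 + 1)) ^ hops v u) \<le> 4 + 2 * \<bar>log 2 ?n\<bar>"
    using \<open>real m \<le> 1 + log 2 ?n\<close> by simp
next
  show "(\<lambda>n. (1 + (4 + 2 * \<bar>log 2 (real n)\<bar>)) * log 2 (real n)) \<in> O(\<lambda>n. (log 2 (real n))\<^sup>2)"
  proof (rule bigoI)
    show "\<forall>\<^sub>F n in sequentially. norm ((1 + (4 + 2 * \<bar>log 2 (real n)\<bar>)) * log 2 (real n))
        \<le> 7 * norm ((log 2 (real n))\<^sup>2)"
      using eventually_ge_at_top[of 2]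
    proof eventually_elim
      case (elim n)
      then have L: "1 \<le> log 2 (real n)" by (simp add: le_log_iff)
      then have "(5 + 2 * log 2 (real n)) * log 2 (real n) \<le> (7 * log 2 (real n)) * log 2 (real n)"
        by (intro mult_right_mono) auto
      then show ?case using L by (simp add: power2_eq_square)
    qed
  qed
qed auto

section \<open>Maximum degree above 2\<close>

text \<open>Levels grow by at most the factor \<Delta>, while \<open>r\<close> is at most
  \<open>\<Delta> powr - \<epsilon>\<close>. Up to the radius where \<open>\<Delta> ^ m\<close>
  reaches \<open>n\<close>, the weighted levels are dominated by a geometric series, and both head
  and tail are of order \<open>n * r ^ m\<close>.\<close>

lemma has_pls_max_degree:
  fixes \<Delta> :: nat
  assumes c: "c > 1" and \<Delta>: "\<Delta> > 2"
  shows "has_pls_of_size c {G :: 'v pair_pre_digraph. max_degree_le \<Delta> G} election_prediction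
    (\<lambda>n. real n powr (1 - 1 / (real \<Delta> * log 2 (real \<Delta>))) * log 2 (real n))"
proof -
  define L where "L = log 2 (real \<Delta>)"
  define \<epsilon> where "\<epsilon> = 1 / (real \<Delta> * L)"
  define K where "K = \<Delta> div 2"
  define r where "r = real K / real (K + 1)"
  have K: "K \<ge> 1" "2 * K \<le> \<Delta>" "\<Delta> \<le> 2 * K + 1" using \<Delta> by (auto simp: K_def)
  have r: "1 / 2 \<le> r" "r < 1" using K(1) by (auto simp: r_def field_simps)
  have L: "L > 1" using \<Delta> by (simp add: L_def less_log_iff)
  then have \<epsilon>: "0 < \<epsilon>" "\<epsilon> < 1"
    using \<Delta> mult_strict_mono[of 1 "real \<Delta>" 1 L] by (auto simp: \<epsilon>_def)
  text \<open>Bernoulli gives \<open>2 \<le> (1 + 1 / K) ^ K\<close>, so \<open>r \<le> 2 powr (- 1 / K) \<le> \<Delta> powr - \<epsilon>\<close>.\<close>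
  have "- 1 \<le> 1 / real K" by (rule order_trans[of _ 0]) auto
  then have "2 \<le> (1 + 1 / real K) ^ K"
    using Bernoulli_inequality[of "1 / real K" K] K(1) by simp
  then have "1 \<le> real K * log 2 (1 + 1 / real K)"
    using K(1) by (simp add: le_log_iff log_nat_power[symmetric] add_pos_nonneg)
  moreover have "1 + 1 / real K = inverse r" using K(1) by (simp add: r_def field_simps)
  ultimately have "1 \<le> real K * - log 2 r" using r by (simp add: log_inverse)
  \<comment> \<open>As \<open>log 2 r\<close> is negative, passing from \<open>K\<close> to \<Delta>
    only weakens the bound; it becomes \<open>log 2 r \<le> - 1 / \<Delta>\<close>, and
    \<open>1 / \<Delta>\<close> is \<open>\<epsilon> * L\<close>.\<close>
  also have "\<dots> \<le> real \<Delta> * - log 2 r" using K r by (intro mult_right_mono) auto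
  finally have log_r: "log 2 r \<le> - \<epsilon> * L"
    using \<Delta> L by (simp add: \<epsilon>_def field_simps)
  have "r = 2 powr log 2 r" using r by simp
  also have "\<dots> \<le> 2 powr (L * - \<epsilon>)" using log_r by (intro powr_mono) (auto simp: mult.commute)
  also have "\<dots> = real \<Delta> powr - \<epsilon>" using \<Delta> by (simp add: L_def powr_powr[symmetric] del: mult_minus_right)
  finally have r_le: "r \<le> real \<Delta> powr - \<epsilon>" .
  have "has_pls_of_size c {G :: 'v pair_pre_digraph. max_degree_le \<Delta> G} election_prediction
    (\<lambda>n. real n powr (1 - \<epsilon>) * log 2 (real n))"
  proof (rule has_pls_of_sizeI[OF c, of K _ "\<lambda>n. (2 * real \<Delta> + 1) * real n powr (1 - \<epsilon>)"])
    fix G :: "'v pair_pre_digraph" and v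
    assume "G \<in> {G. max_degree_le \<Delta> G}" "network G" and v: "v \<in> pverts G"
    then have deg: "max_degree_le \<Delta> G" by simp
    interpret net G using \<open>network G\<close> by unfold_locales
    let ?n = "real (card (pverts G))"
    \<comment> \<open>At this cutoff \<open>\<Delta> ^ m\<close> lies between \<open>n\<close> and
      \<open>\<Delta> * n\<close>: the lower bound controls \<open>r ^ m\<close>, the upper one the
      levels inside.\<close>
    define m where "m = nat \<lceil>log (real \<Delta>) ?n\<rceil>"
    have n1: "1 \<le> ?n" using card_verts_pos by simp
    then have m: "log (real \<Delta>) ?n \<le> real m" "real m \<le> 1 + log (real \<Delta>) ?n"
      using \<Delta> by (auto simp: m_def) linarith
    then have n_le: "?n \<le> real \<Delta> ^ m" using n1 \<Delta> by (simp add: log_le_iff powr_realpow)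
    have "real \<Delta> powr real m \<le> real \<Delta> powr (1 + log (real \<Delta>) ?n)"
      using m \<Delta> by (intro powr_mono) auto
    then have le_n: "real \<Delta> ^ m \<le> real \<Delta> * ?n"
      using n1 \<Delta> by (simp add: powr_realpow powr_add)
    have "r ^ m \<le> (real \<Delta> powr - \<epsilon>) ^ m" using r_le r by (intro power_mono) auto
    also have "\<dots> = (real \<Delta> ^ m) powr - \<epsilon>"
      using \<Delta> by (simp add: powr_power powr_realpow[symmetric] powr_powr mult.commute)
    also have "\<dots> \<le> ?n powr - \<epsilon>"
      using n_le n1 \<epsilon> by (intro powr_mono2') auto
    finally have rm: "r ^ m \<le> ?n powr - \<epsilon>" .
    define q where "q = real \<Delta> * r"
    \<comment> \<open>A ratio of at least 3/2, from \<open>\<Delta> \<ge> 3\<close> and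
      \<open>r \<ge> 1 / 2\<close>, keeps the geometric sum below \<open>2 * q ^ m\<close>.\<close>
    have "3 * (1 / 2) \<le> q" unfolding q_def using \<Delta> r by (intro mult_mono) auto
    have level: "real (card (level v i)) * r ^ i \<le> q ^ i" for i
    proof -
      have "card (level v i) \<le> \<Delta> ^ i"
      proof (cases i)
        case 0 then show ?thesis using v by (simp add: level_0)
      next
        case (Suc j)
        have "\<Delta> * (\<Delta> - 1) ^ j \<le> \<Delta> * \<Delta> ^ j" by (intro mult_left_mono power_mono) auto
        with card_level_le[OF v deg] have "card (level v (Suc j)) \<le> \<Delta> * \<Delta> ^ j"
          by (rule order_trans)
        then show ?thesis by (simp add: Suc)
      qed
      then have "real (card (level v i)) \<le> real \<Delta> ^ i" by (simp flip: of_nat_power)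
      then show ?thesis using r by (auto simp: q_def power_mult_distrib intro!: mult_right_mono)
    qed
    have "(\<Sum>i<m. real (card (level v i)) * r ^ i) \<le> (\<Sum>i<m. q ^ i)"
      by (intro sum_mono level)
    also have "\<dots> \<le> 2 * q ^ m"
    proof -
      have "(q - 1) * (\<Sum>i<m. q ^ i) \<le> q ^ m"
        using power_diff_1_eq[of q m] by linarith
      moreover have "1 / 2 * (\<Sum>i<m. q ^ i) \<le> (q - 1) * (\<Sum>i<m. q ^ i)"
        using \<open>3 * (1 / 2) \<le> q\<close> by (intro mult_right_mono sum_nonneg) auto
      ultimately show ?thesis by linarith
    qed
    also have "\<dots> \<le> 2 * ((real \<Delta> * ?n) * r ^ m)"
      unfolding q_def power_mult_distrib using le_n r by (intro mult_left_mono mult_right_mono) auto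
    finally have head: "(\<Sum>i<m. real (card (level v i)) * r ^ i) \<le> 2 * real \<Delta> * (?n * r ^ m)"
      by (simp add: mult.assoc)
    have tail: "real (card {u \<in> pverts G. m \<le> hops v u}) * r ^ m \<le> ?n * r ^ m"
      using finite_verts r by (intro mult_right_mono) (auto intro!: card_mono)
    have "(\<Sum>u\<in>pverts G. r ^ hops v u) \<le> (2 * real \<Delta> + 1) * (?n * r ^ m)"
    proof -
      have "(\<Sum>u\<in>pverts G. r ^ hops v u) \<le>
          (\<Sum>i<m. real (card (level v i)) * r ^ i) + real (card {u \<in> pverts G. m \<le> hops v u}) * r ^ m"
        using r by (intro sum_power_hops_le) auto
      then show ?thesis using head tail unfolding distrib_right by linarith
    qed
    also have "\<dots> \<le> (2 * real \<Delta> + 1) * (?n * ?n powr - \<epsilon>)"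
      by (intro mult_left_mono rm) auto
    also have "?n * ?n powr - \<epsilon> = ?n powr (1 - \<epsilon>)"
      using n1 by (simp add: powr_diff powr_minus field_simps)
    finally show "(\<Sum>u\<in>pverts G. (real K / real (K + 1)) ^ hops v u) \<le> (2 * real \<Delta> + 1) * ?n powr (1 - \<epsilon>)"
      by (simp add: r_def)
  next
    show "(\<lambda>n. (1 + (2 * real \<Delta> + 1) * real n powr (1 - \<epsilon>)) * log 2 (real n))
        \<in> O(\<lambda>n. real n powr (1 - \<epsilon>) * log 2 (real n))"
    proof (rule bigoI)
      show "\<forall>\<^sub>F n in sequentially. norm ((1 + (2 * real \<Delta> + 1) * real n powr (1 - \<epsilon>)) * log 2 (real n))
          \<le> (2 * real \<Delta> + 2) * norm (real n powr (1 - \<epsilon>) * log 2 (real n))"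
        using eventually_ge_at_top[of 1]
      proof eventually_elim
        case (elim n)
        then have L: "0 \<le> log 2 (real n)" and "1 \<le> real n powr (1 - \<epsilon>)"
          using \<epsilon> by (auto intro: ge_one_powr_ge_zero)
        then have "(1 + (2 * real \<Delta> + 1) * real n powr (1 - \<epsilon>)) * log 2 (real n)
            \<le> ((2 * real \<Delta> + 2) * real n powr (1 - \<epsilon>)) * log 2 (real n)"
          by (intro mult_right_mono) (auto simp: algebra_simps)
        moreover have "0 \<le> 1 + (2 * real \<Delta> + 1) * real n powr (1 - \<epsilon>)" by simp
        ultimately show ?case using L by (simp add: abs_mult mult.assoc)
      qed
    qed
  next
    fix G :: "'v pair_pre_digraph"
    assume "G \<in> {G. max_degree_le \<Delta> G}"
    then show "max_degree_le (2 * K + 1) G"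
      using K(3) order_trans by (auto simp: max_degree_le_def)
  next
    show "K > 0" using K(1) by simp
  qed simp
  then show ?thesis by (simp add: \<epsilon>_def L_def)
qed

theorem theorem3:
  fixes c :: real
  assumes "c > 1"
  shows
    "(\<forall>f (\<F> :: 'v pair_pre_digraph set).
        sub_exponential f \<and> family_bounded_growth f \<F> \<longrightarrow>
        has_pls_of_size c \<F> election_prediction (\<lambda>n. log 2 (real n))) \<and>
     has_pls_of_size c {G :: 'v pair_pre_digraph. max_degree_le 3 G} election_prediction
       (\<lambda>n. (log 2 (real n))\<^sup>2) \<and>
     (\<forall>\<Delta> :: nat. \<Delta> > 2 \<longrightarrow>
        has_pls_of_size c {G :: 'v pair_pre_digraph. max_degree_le \<Delta> G} election_prediction
          (\<lambda>n. real n powr (1 - 1 / (real \<Delta> * log 2 (real \<Delta>))) * log 2 (real n)))"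
  using has_pls_sub_exponential[OF assms] has_pls_max_degree_3[OF assms] has_pls_max_degree[OF assms]
  by blast

end
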